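(* Let $G$ be an $F_6$-free graph with $m\geq 88$ edges. Then $$\lambda(G)\leq \frac{1+\sqrt{4m-3}}{2},$$ and equality holds if and only if $G\cong K_2\vee \frac{m-1}{2}K_1$.
   Context: All graphs are simple, finite and undirected. $\lambda(G)$ denotes the spectral radius (largest adjacency eigenvalue) of $G$. $P_n$ is the path on $n$ vertices, $K_n$ the complete graph, and $tK_1$ the empty graph on $t$ vertices. The join $G\vee H$ is obtained from the disjoint union $G\cup H$ by adding all edges between $V(G)$ and $V(H)$. The fan graph is $F_k=K_1\vee P_{k-1}$ (so $F_6=K_1\vee P_5$). A graph is $F$-free if it contains no subgraph isomorphic to $F$.
   Formalization: In the equality case, G is taken up to isolated vertices: equality holds iff m is odd and G with its isolated vertices removed is isomorphic to K_2 ∨ ((m-1)/2)K_1, since adding isolated vertices to that graph preserves m, F_6-freeness and λ. *)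

theory Defs
  imports Complex_Main
begin

type_synonym 'a graph = "'a set \<times> 'a set set"

definition simple_graph :: "'a graph \<Rightarrow> bool" where
  "simple_graph G \<longleftrightarrow> finite (fst G) \<and>
     (\<forall>e\<in>snd G. \<exists>u v. u \<noteq> v \<and> u \<in> fst G \<and> v \<in> fst G \<and> e = {u, v})"

definition num_edges :: "'a graph \<Rightarrow> nat" where
  "num_edges G = card (snd G)"

(* mu is an eigenvalue of the adjacency matrix A(G) = (a_{vu}), a_{vu} = 1 iff {u,v} is an edge:
   there is a nonzero vector x in R^V with A x = mu x.  (A is real symmetric, so all its
   eigenvalues are real and have real eigenvectors.) *)
definition adj_eigenvalue :: "'a graph \<Rightarrow> real \<Rightarrow> bool" where
  "adj_eigenvalue G mu \<longleftrightarrow> (\<exists>x :: 'a \<Rightarrow> real.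
     (\<exists>v\<in>fst G. x v \<noteq> 0) \<and>
     (\<forall>v\<in>fst G. (\<Sum>u\<in>{u\<in>fst G. {u, v} \<in> snd G}. x u) = mu * x v))"

definition spectral_radius :: "'a graph \<Rightarrow> real" where
  "spectral_radius G = Max {mu. adj_eigenvalue G mu}"

definition contains_subgraph :: "'a graph \<Rightarrow> 'b graph \<Rightarrow> bool" where
  "contains_subgraph G H \<longleftrightarrow> (\<exists>f. inj_on f (fst H) \<and> f ` fst H \<subseteq> fst G \<and>
       (\<forall>e\<in>snd H. f ` e \<in> snd G))"

definition graph_iso :: "'a graph \<Rightarrow> 'b graph \<Rightarrow> bool" where
  "graph_iso G H \<longleftrightarrow> (\<exists>f. bij_betw f (fst G) (fst H) \<and>
       (\<forall>u\<in>fst G. \<forall>v\<in>fst G. {u, v} \<in> snd G \<longleftrightarrow> {f u, f v} \<in> snd H))"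

definition path_graph :: "nat \<Rightarrow> nat graph" where
  "path_graph n = ({0..<n}, {{i, Suc i} | i. Suc i < n})"

definition complete_graph :: "nat \<Rightarrow> nat graph" where
  "complete_graph n = ({0..<n}, {{i, j} | i j. i < n \<and> j < n \<and> i \<noteq> j})"

definition empty_graph :: "nat \<Rightarrow> nat graph" where
  "empty_graph t = ({0..<t}, {})"

definition join :: "'a graph \<Rightarrow> 'b graph \<Rightarrow> ('a + 'b) graph" where
  "join G H = (Inl ` fst G \<union> Inr ` fst H,
     (\<lambda>e. Inl ` e) ` snd G \<union> (\<lambda>e. Inr ` e) ` snd H \<union>
     {{Inl u, Inr v} | u v. u \<in> fst G \<and> v \<in> fst H})"

definition fan_graph :: "nat \<Rightarrow> (nat + nat) graph" where
  "fan_graph k = join (complete_graph 1) (path_graph (k - 1))"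

definition free_of :: "'a graph \<Rightarrow> 'b graph \<Rightarrow> bool" where
  "free_of G F \<longleftrightarrow> \<not> contains_subgraph G F"

definition drop_isolated :: "'a graph \<Rightarrow> 'a graph" where
  "drop_isolated G = ({v\<in>fst G. \<exists>e\<in>snd G. v \<in> e}, snd G)"

end

(* Let u be a vertex at which the Perron vector x attains its maximum 1, N its neighbourhood and W
   the set of remaining vertices.  Expanding rho^2 x_u and subtracting rho x_u, the assumption
   rho^2 - rho >= m - 1 becomes
     sum_{w in W} (d_N(w) (1 - x_w) + d_W(w)/2) <= 1 + sum_{v in N} ((d_N(v) - 1) x_v - d_N(v)/2).
   As G[N] has no P_5, a discharging argument shows that the sum on the right is nonpositive, up to
   components of G[N] on four vertices with two adjacent vertices of degree three; those are excluded
   because their four eigenvector entries would need more weight on W than there are edges.  Hence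
   the left side is at most 1.  So the vertices of W with a neighbour in N miss, in total, little of
   the weight of N.  This rules out four-cycles and triangles in G[N]: their vertices need many
   neighbours in W, but two vertices of W joined to all of such a cycle create F_6.  The remaining
   forest can only be a spanning star of G[N], and the vertices of W are isolated. *)
theory Submission
  imports Defs "HOL-Analysis.Function_Topology"
begin

section \<open>Eigenvalues of symmetric kernels\<close>

text \<open>\<open>G\<close> may be disconnected, so the Perron vector is only known to be
  nonnegative; positivity on \<open>N\<close> has to be recovered from adjacency to
  \<open>u\<close>. The analysis assumes that \<open>\<rho>\<close> is at least the bound, not
  strictly above it, so one argument serves both the inequality and the equality case: it forces the
  extremal graph and thereby the value of \<open>\<rho>\<close>. The proof is a budget computation:
  loss on \<open>W\<close> plus cost on \<open>N\<close> is at most 1. This budget is sharp: in the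
  extremal graph the centre of the star has weight 1 and only leaves as neighbours in
  \<open>N\<close>, hence cost exactly 1, while its leaves cost 0. A cheap configuration must
  therefore have heavy vertices, and the eigenvalue equations turn this into a demand for weight
  from \<open>W\<close> that the remaining budget cannot supply. The size hypothesis enters the
  estimates through \<open>\<rho> \<ge> 49/5\<close>. The tightest of them is the triangle with a
  pendant edge, which needs \<open>\<rho> > 85/9\<close>; the diamond needs
  \<open>\<rho> > 9\<close>.\<close>

lemma quadratic_vanish:
  fixes c d :: real
  assumes "\<And>t. 2 * t * c \<le> t\<^sup>2 * d"
  shows "c = 0"
proof (rule ccontr)
  assume "c \<noteq> 0"
  define s where "s = \<bar>d\<bar> + 1"
  have s: "s > 0" "d < s" by (auto simp: s_def)
  have "2 * (c / s) * c \<le> (c / s)\<^sup>2 * d" by (rule assms)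
  also have "\<dots> \<le> (c / s)\<^sup>2 * s" using s by (intro mult_left_mono) auto
  also have "\<dots> = (c / s) * c" using s by (simp add: power2_eq_square)
  finally have "c * c / s \<le> 0" by simp
  moreover have "c * c / s > 0"
    using s \<open>c \<noteq> 0\<close> by (intro divide_pos_pos) (auto simp: zero_less_mult_iff)
  ultimately show False by simp
qed

text \<open>A maximiser of the quadratic form on the unit sphere. Its absolute value is a maximiser
  too because \<open>M\<close> is nonnegative, and the first variation in each coordinate gives the
  eigenvalue equation.\<close>

lemma perron_vector:
  fixes V :: "'a set" and M :: "'a \<Rightarrow> 'a \<Rightarrow> real"
  assumes fin: "finite V" and ne: "V \<noteq> {}"
    and sym: "\<And>a b. M a b = M b a" and nonneg: "\<And>a b. M a b \<ge> 0"
  shows "\<exists>r y. (\<forall>v. y v \<ge> 0) \<and> (\<forall>v. v \<notin> V \<longrightarrow> y v = 0) \<and> (\<exists>v\<in>V. y v \<noteq> 0) \<and>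
    (\<forall>v\<in>V. (\<Sum>b\<in>V. M v b * y b) = r * y v) \<and>
    (\<forall>z. (\<Sum>a\<in>V. \<Sum>b\<in>V. M a b * z a * z b) \<le> r * (\<Sum>a\<in>V. (z a)\<^sup>2))"
proof -
  define q where "q z = (\<Sum>a\<in>V. \<Sum>b\<in>V. M a b * z a * z b)" for z
  define n where "n z = (\<Sum>a\<in>V. (z a)\<^sup>2)" for z :: "'a \<Rightarrow> real"
  \<comment> \<open>The vertex type may be infinite; fixing the value 0 outside \<open>V\<close>
    makes the box compact in the product topology.\<close>
  define B where "B = (\<Pi>\<^sub>E v\<in>UNIV. if v \<in> V then {-1..1} else {0::real})"
  define K where "K = B \<inter> {z. n z = 1}"
  have "compactin (product_topology (\<lambda>_. euclidean) UNIV) B"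
    unfolding B_def by (subst compactin_PiE) auto
  then have "compact B" by (simp add: euclidean_product_topology)
  moreover have "continuous_on UNIV n"
    unfolding n_def by (intro continuous_intros continuous_on_product_coordinates)
  then have "closed {z. n z = 1}"
    by (intro closed_Collect_eq) (auto intro: continuous_intros)
  ultimately have "compact K" unfolding K_def by (rule compact_Int_closed)
  have K_iff: "z \<in> K \<longleftrightarrow> (\<forall>v. v \<notin> V \<longrightarrow> z v = 0) \<and> n z = 1" for z
  proof -
    have "\<bar>z v\<bar> \<le> 1" if "n z = 1" "v \<in> V" for v
    proof -
      have "(z v)\<^sup>2 \<le> n z" unfolding n_def using fin that by (intro member_le_sum) auto
      then show ?thesis using that by (simp add: abs_le_square_iff[of _ 1, simplified])
    qed
    then have bound: "- 1 \<le> z v \<and> z v \<le> 1" if "n z = 1" "v \<in> V" for v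
      using that by (simp add: abs_le_iff minus_le_iff)
    show ?thesis unfolding K_def B_def PiE_def Pi_def extensional_def
      using bound by (auto split: if_splits)
  qed
  obtain v0 where v0: "v0 \<in> V" using ne by blast
  have "n (\<lambda>v. of_bool (v = v0)) = 1"
    unfolding n_def using fin v0 by (simp add: of_bool_def if_distrib[where f = "\<lambda>t. t\<^sup>2"] cong: if_cong)
  then have "(\<lambda>v. of_bool (v = v0)) \<in> K" using v0 by (auto simp: K_iff)
  then have "K \<noteq> {}" by blast
  have "continuous_on K q"
    unfolding q_def by (intro continuous_intros continuous_on_subset[OF continuous_on_product_coordinates]) auto
  from continuous_attains_sup[OF \<open>compact K\<close> \<open>K \<noteq> {}\<close> this]
  obtain z0 where z0: "z0 \<in> K" "\<And>z. z \<in> K \<Longrightarrow> q z \<le> q z0" by blast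
  define r where "r = q z0"
  define y where "y v = \<bar>z0 v\<bar>" for v
  have yK: "y \<in> K" using z0(1) unfolding K_iff by (simp add: y_def n_def)
  have "q z0 \<le> q y"
    unfolding q_def y_def
  proof (intro sum_mono)
    fix a b
    have "M a b * z0 a * z0 b \<le> \<bar>M a b * z0 a * z0 b\<bar>" by simp
    then show "M a b * z0 a * z0 b \<le> M a b * \<bar>z0 a\<bar> * \<bar>z0 b\<bar>"
      using nonneg[of a b] by (simp add: abs_mult)
  qed
  then have qy: "q y = r" using z0(2)[OF yK] by (simp add: r_def)
  have rayleigh: "q z \<le> r * n z" for z
  proof (cases "n z = 0")
    case True
    then have "z v = 0" if "v \<in> V" for v using that fin by (simp add: n_def sum_nonneg_eq_0_iff)
    then have "q z = 0" unfolding q_def by simp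
    with True show ?thesis by simp
  next
    case False
    then have pos: "n z > 0" unfolding n_def by (simp add: sum_nonneg less_le)
    define z' where "z' v = (if v \<in> V then z v / sqrt (n z) else 0)" for v
    have "n z' = n z / n z"
      using pos by (simp add: n_def[of z'] z'_def power_divide sum_divide_distrib[symmetric]) (simp add: n_def)
    then have "z' \<in> K" using pos by (simp add: K_iff z'_def)
    then have "q z' \<le> r" using z0(2) by (simp add: r_def)
    moreover have "q z' = q z / n z"
    proof -
      have "q z' = (\<Sum>a\<in>V. \<Sum>b\<in>V. M a b * z a * z b / n z)"
        unfolding q_def[of z'] using pos by (intro sum.cong refl) (simp add: z'_def)
      then show ?thesis by (simp add: q_def sum_divide_distrib)
    qed
    ultimately show ?thesis using pos by (simp add: pos_divide_le_eq)
  qed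
  have "(\<Sum>b\<in>V. M v b * y b) = r * y v" if v: "v \<in> V" for v
  proof -
    let ?A = "\<Sum>b\<in>V. M v b * y b"
    \<comment> \<open>Compare the maximiser with its perturbation by \<open>t\<close> in the
      coordinate \<open>v\<close>.\<close>
    have "2 * t * (?A - r * y v) \<le> t\<^sup>2 * (r - M v v)" for t
    proof -
      let ?e = "\<lambda>b. if b = v then t else 0"
      have "q (\<lambda>b. y b + ?e b) = (\<Sum>a\<in>V. \<Sum>b\<in>V. M a b * y a * y b)
          + (\<Sum>a\<in>V. \<Sum>b\<in>V. M a b * y a * ?e b) + (\<Sum>a\<in>V. \<Sum>b\<in>V. M a b * ?e a * y b)
          + (\<Sum>a\<in>V. \<Sum>b\<in>V. M a b * ?e a * ?e b)"
        unfolding q_def by (simp only: sum.distrib[symmetric]) (intro sum.cong refl, simp add: algebra_simps)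
      also have "(\<Sum>a\<in>V. \<Sum>b\<in>V. M a b * y a * ?e b) = t * ?A"
        using fin v by (simp add: if_distrib[where f = "\<lambda>t. _ * t"] sum_distrib_left sym[of v] mult_ac cong: if_cong)
      also have "(\<Sum>a\<in>V. \<Sum>b\<in>V. M a b * ?e a * y b) = t * ?A"
      proof -
        have "(\<Sum>a\<in>V. \<Sum>b\<in>V. M a b * ?e a * y b) = (\<Sum>a\<in>V. if a = v then t * ?A else 0)"
          by (intro sum.cong refl) (simp add: sum_distrib_left mult_ac)
        then show ?thesis using fin v by simp
      qed
      also have "(\<Sum>a\<in>V. \<Sum>b\<in>V. M a b * ?e a * ?e b) = t\<^sup>2 * M v v"
      proof -
        have "(\<Sum>a\<in>V. \<Sum>b\<in>V. M a b * ?e a * ?e b) = (\<Sum>a\<in>V. if a = v then t\<^sup>2 * M v v else 0)"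
          using fin v by (intro sum.cong refl) (simp add: if_distrib[where f = "\<lambda>t. _ * t"] power2_eq_square mult_ac cong: if_cong)
        then show ?thesis using fin v by simp
      qed
      finally have q: "q (\<lambda>b. y b + ?e b) = r + 2 * t * ?A + t\<^sup>2 * M v v"
        using qy unfolding q_def by simp
      have "n (\<lambda>b. y b + ?e b) = (\<Sum>b\<in>V. (y b)\<^sup>2 + (if b = v then 2 * t * y v + t\<^sup>2 else 0))"
        unfolding n_def by (intro sum.cong refl) (simp add: power2_sum)
      also have "\<dots> = 1 + 2 * t * y v + t\<^sup>2"
        using yK fin v unfolding K_iff n_def by (simp add: sum.distrib)
      finally have "r + 2 * t * ?A + t\<^sup>2 * M v v \<le> r * (1 + 2 * t * y v + t\<^sup>2)"
        using rayleigh[of "\<lambda>b. y b + ?e b"] q by simp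
      then show ?thesis by (simp add: algebra_simps)
    qed
    then have "?A - r * y v = 0" by (rule quadratic_vanish)
    then show ?thesis by simp
  qed
  moreover have "\<exists>v\<in>V. y v \<noteq> 0"
  proof (rule ccontr)
    assume "\<not> (\<exists>v\<in>V. y v \<noteq> 0)"
    then have "n y = 0" unfolding n_def by simp
    with yK show False by (simp add: K_iff)
  qed
  moreover have "y v = 0" if "v \<notin> V" for v using that yK by (simp add: K_iff)
  moreover have "y v \<ge> 0" for v by (simp add: y_def)
  ultimately show ?thesis
    using rayleigh unfolding q_def n_def by blast
qed

text \<open>\<open>Max\<close> in \<open>spectral_radius\<close> is meaningful only for a finite
  set. Eigenvectors for distinct eigenvalues are orthogonal, and Bessel's inequality, summed over
  the coordinate vectors of \<open>V\<close>, allows at most \<open>card V\<close> of them.\<close>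

lemma finite_eigenvalues:
  fixes V :: "'a set" and M :: "'a \<Rightarrow> 'a \<Rightarrow> real"
  assumes fin: "finite V" and sym: "\<And>a b. M a b = M b a"
  shows "finite {r. \<exists>z. (\<exists>v\<in>V. z v \<noteq> 0) \<and> (\<forall>v\<in>V. (\<Sum>b\<in>V. M v b * z b) = r * z v)}" (is "finite ?E")
proof (rule ccontr)
  assume "infinite ?E"
  then obtain S where S: "S \<subseteq> ?E" "finite S" "card S = card V + 1"
    using infinite_arbitrarily_large by blast
  then have "\<forall>r\<in>S. \<exists>z. (\<exists>v\<in>V. z v \<noteq> 0) \<and> (\<forall>v\<in>V. (\<Sum>b\<in>V. M v b * z b) = r * z v)" by blast
  then obtain Z where Z: "\<And>r. r \<in> S \<Longrightarrow> \<exists>v\<in>V. Z r v \<noteq> 0"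
    "\<And>r v. r \<in> S \<Longrightarrow> v \<in> V \<Longrightarrow> (\<Sum>b\<in>V. M v b * Z r b) = r * Z r v"
    by metis
  define ip where "ip f g = (\<Sum>v\<in>V. f v * g v)" for f g :: "'a \<Rightarrow> real"
  have pos: "ip (Z r) (Z r) > 0" if "r \<in> S" for r
  proof -
    obtain v where v: "v \<in> V" "Z r v \<noteq> 0" using Z(1)[OF \<open>r \<in> S\<close>] by blast
    then have "0 < Z r v * Z r v" by (auto simp: zero_less_mult_iff)
    also have "\<dots> \<le> ip (Z r) (Z r)" unfolding ip_def using fin v by (intro member_le_sum) auto
    finally show ?thesis .
  qed
  have orth: "ip (Z r) (Z s) = 0" if "r \<in> S" "s \<in> S" "r \<noteq> s" for r s
  proof -
    have "r * ip (Z r) (Z s) = (\<Sum>v\<in>V. (\<Sum>b\<in>V. M v b * Z r b) * Z s v)"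
      unfolding ip_def using Z(2)[OF that(1)] by (simp add: sum_distrib_left mult_ac)
    also have "\<dots> = (\<Sum>b\<in>V. \<Sum>v\<in>V. M v b * Z r b * Z s v)"
      unfolding sum_distrib_right by (rule sum.swap)
    also have "\<dots> = (\<Sum>b\<in>V. Z r b * (\<Sum>v\<in>V. M b v * Z s v))"
      unfolding sum_distrib_left by (intro sum.cong refl) (simp add: sym[of b for b] mult_ac)
    also have "\<dots> = s * ip (Z r) (Z s)"
      unfolding ip_def using Z(2)[OF that(2)] by (simp add: sum_distrib_left mult_ac)
    finally show ?thesis using that(3) by simp
  qed
  define e where "e r v = Z r v / sqrt (ip (Z r) (Z r))" for r v
  have ip_e: "ip (e r) (e s) = of_bool (r = s)" if "r \<in> S" "s \<in> S" for r s
  proof -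
    have "ip (e r) (e s) = ip (Z r) (Z s) / (sqrt (ip (Z r) (Z r)) * sqrt (ip (Z s) (Z s)))"
      unfolding ip_def[of "e r"] e_def by (simp add: ip_def[of "Z r" "Z s"] sum_divide_distrib)
    then show ?thesis using pos[OF that(1)] orth[OF that] by (cases "r = s") auto
  qed
  \<comment> \<open>Here \<open>?p\<close> is the projection of the coordinate vector at
    \<open>v\<close> to the span of the vectors \<open>e r\<close>.\<close>
  have bessel: "(\<Sum>r\<in>S. (e r v)\<^sup>2) \<le> 1" if v: "v \<in> V" for v
  proof -
    let ?p = "\<lambda>w. \<Sum>r\<in>S. e r v * e r w"
    have cross: "(\<Sum>w\<in>V. of_bool (w = v) * ?p w) = (\<Sum>r\<in>S. (e r v)\<^sup>2)"
    proof -
      have "(\<Sum>w\<in>V. of_bool (w = v) * ?p w) = (\<Sum>w\<in>V. if w = v then ?p v else 0)"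
        by (intro sum.cong) auto
      then show ?thesis using fin v by (simp add: power2_eq_square)
    qed
    have "(\<Sum>w\<in>V. ?p w * ?p w) = (\<Sum>w\<in>V. \<Sum>r\<in>S. \<Sum>s\<in>S. e r v * e s v * (e r w * e s w))"
      by (simp add: sum_product mult_ac)
    also have "\<dots> = (\<Sum>r\<in>S. \<Sum>w\<in>V. \<Sum>s\<in>S. e r v * e s v * (e r w * e s w))"
      by (rule sum.swap)
    also have "\<dots> = (\<Sum>r\<in>S. \<Sum>s\<in>S. \<Sum>w\<in>V. e r v * e s v * (e r w * e s w))"
      by (intro sum.cong refl sum.swap)
    also have "\<dots> = (\<Sum>r\<in>S. \<Sum>s\<in>S. e r v * e s v * ip (e r) (e s))"
      by (simp add: ip_def sum_distrib_left)
    also have "\<dots> = (\<Sum>r\<in>S. \<Sum>s\<in>S. if s = r then (e r v)\<^sup>2 else 0)"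
      using ip_e by (intro sum.cong refl) (auto simp: power2_eq_square)
    also have "\<dots> = (\<Sum>r\<in>S. (e r v)\<^sup>2)" using S(2) by simp
    finally have square: "(\<Sum>w\<in>V. ?p w * ?p w) = (\<Sum>r\<in>S. (e r v)\<^sup>2)" .
    have "0 \<le> (\<Sum>w\<in>V. (of_bool (w = v) - ?p w)\<^sup>2)" by (intro sum_nonneg) simp
    also have "\<dots> = (\<Sum>w\<in>V. of_bool (w = v) - 2 * (of_bool (w = v) * ?p w) + ?p w * ?p w)"
      by (intro sum.cong refl) (simp add: power2_eq_square algebra_simps)
    also have "\<dots> = 1 - 2 * (\<Sum>w\<in>V. of_bool (w = v) * ?p w) + (\<Sum>w\<in>V. ?p w * ?p w)"
      using fin v by (simp add: sum.distrib sum_subtractf sum_distrib_left[symmetric] of_bool_def cong: if_cong)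
    finally show ?thesis unfolding cross square by simp
  qed
  have "real (card S) = (\<Sum>r\<in>S. ip (e r) (e r))" using ip_e by simp
  also have "\<dots> = (\<Sum>v\<in>V. \<Sum>r\<in>S. (e r v)\<^sup>2)"
    unfolding ip_def power2_eq_square by (rule sum.swap)
  also have "\<dots> \<le> real (card V)" using sum_mono[OF bessel] by simp
  finally show False using S(3) by simp
qed

lemma adj_eigenvalue_kernel:
  fixes G :: "'a graph"
  assumes "finite (fst G)"
  shows "adj_eigenvalue G r \<longleftrightarrow> (\<exists>z. (\<exists>v\<in>fst G. z v \<noteq> 0) \<and>
    (\<forall>v\<in>fst G. (\<Sum>b\<in>fst G. of_bool ({v, b} \<in> snd G) * z b) = r * z v))"
proof -
  have "(\<Sum>b\<in>{b\<in>fst G. {b, v} \<in> snd G}. z b) = (\<Sum>b\<in>fst G. of_bool ({v, b} \<in> snd G) * z b)"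
    for z :: "'a \<Rightarrow> real" and v
    using assms by (intro sum.mono_neutral_cong_left) (auto simp: insert_commute)
  then show ?thesis unfolding adj_eigenvalue_def by simp
qed

text \<open>The Rayleigh bound, tested on an eigenvector for any eigenvalue \<open>s\<close>, shows
  \<open>s \<le> r\<close>; so the eigenvalue of the maximiser is the \<open>Max\<close>.\<close>

lemma spectral_radius_perron:
  assumes fin: "finite (fst G)" and ne: "fst G \<noteq> {}"
  obtains y where "\<And>v. y v \<ge> 0" "\<And>v. v \<notin> fst G \<Longrightarrow> y v = 0" "\<exists>v\<in>fst G. y v \<noteq> 0"
    "\<And>v. v \<in> fst G \<Longrightarrow> (\<Sum>b\<in>fst G. of_bool ({v, b} \<in> snd G) * y b) = spectral_radius G * y v"
proof -
  let ?M = "\<lambda>a b. of_bool ({a, b} \<in> snd G) :: real"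
  have sym: "?M a b = ?M b a" for a b by (simp add: insert_commute)
  have nn: "?M a b \<ge> 0" for a b by simp
  obtain r y where y: "\<And>v. y v \<ge> 0" "\<And>v. v \<notin> fst G \<Longrightarrow> y v = 0" "\<exists>v\<in>fst G. y v \<noteq> 0"
    "\<And>v. v \<in> fst G \<Longrightarrow> (\<Sum>b\<in>fst G. ?M v b * y b) = r * y v"
    and ray: "\<And>z. (\<Sum>a\<in>fst G. \<Sum>b\<in>fst G. ?M a b * z a * z b) \<le> r * (\<Sum>a\<in>fst G. (z a)\<^sup>2)"
    using perron_vector[OF fin ne, of ?M, OF sym nn] by blast
  have "spectral_radius G = r"
    unfolding spectral_radius_def
  proof (rule Max_eqI)
    show "finite {mu. adj_eigenvalue G mu}"
      using finite_eigenvalues[OF fin, of ?M, OF sym] by (simp add: adj_eigenvalue_kernel[OF fin])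
    show "r \<in> {mu. adj_eigenvalue G mu}" using y by (auto simp: adj_eigenvalue_kernel[OF fin])
    fix s assume "s \<in> {mu. adj_eigenvalue G mu}"
    then obtain z where z: "\<exists>v\<in>fst G. z v \<noteq> 0"
      "\<And>v. v \<in> fst G \<Longrightarrow> (\<Sum>b\<in>fst G. ?M v b * z b) = s * z v"
      by (auto simp: adj_eigenvalue_kernel[OF fin])
    have "(\<Sum>a\<in>fst G. \<Sum>b\<in>fst G. ?M a b * z a * z b) = (\<Sum>a\<in>fst G. z a * (\<Sum>b\<in>fst G. ?M a b * z b))"
      by (simp add: sum_distrib_left mult_ac del: sum_of_bool_mult_eq sum_mult_of_bool_eq)
    also have "\<dots> = s * (\<Sum>a\<in>fst G. (z a)\<^sup>2)"
      using z(2) by (simp add: sum_distrib_left power2_eq_square mult_ac del: sum_of_bool_mult_eq sum_mult_of_bool_eq)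
    finally have "s * (\<Sum>a\<in>fst G. (z a)\<^sup>2) \<le> r * (\<Sum>a\<in>fst G. (z a)\<^sup>2)" using ray[of z] by simp
    moreover have "(\<Sum>a\<in>fst G. (z a)\<^sup>2) > 0"
      using z(1) fin by (meson sum_pos2 zero_le_power2 zero_less_power2)
    ultimately show "s \<le> r" by simp
  qed
  with y show ?thesis using that by blast
qed

lemma adj_eigenvalue_le:
  assumes "finite (fst G)" "adj_eigenvalue G r"
  shows "r \<le> spectral_radius G"
  unfolding spectral_radius_def
proof (rule Max_ge)
  show "finite {mu. adj_eigenvalue G mu}"
    using finite_eigenvalues[OF assms(1), of "\<lambda>a b. of_bool ({a, b} \<in> snd G)"]
    by (simp add: adj_eigenvalue_kernel[OF assms(1)] insert_commute)
qed (use assms in simp)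

section \<open>The neighbourhood of a vertex of maximal Perron weight\<close>

lemma card_filter_of_bool: "finite A \<Longrightarrow> real (card {y \<in> A. P y}) = (\<Sum>y\<in>A. of_bool (P y))"
  by (simp add: Int_def)

text \<open>The assumption \<open>size\<close> is \<open>m - 1 \<le> \<rho>\<^sup>2 - \<rho>\<close>
  doubled, as its left side counts every edge twice. In \<open>no_fan\<close> only nonconsecutive
  path vertices need an explicit inequality, because adjacent vertices are distinct anyway.\<close>

locale fan_free_eigenvector =
  fixes V :: "'a set" and adj :: "'a \<Rightarrow> 'a \<Rightarrow> bool"
    and x :: "'a \<Rightarrow> real" and \<rho> :: real and u :: 'a
  assumes finite_V: "finite V"
    and adj_sym: "adj a b \<Longrightarrow> adj b a"
    and adj_irrefl: "\<not> adj a a"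
    and adj_V: "adj a b \<Longrightarrow> a \<in> V"
    and no_fan: "\<lbrakk>adj h a; adj h b; adj h c; adj h d; adj h e; adj a b; adj b c; adj c d; adj d e;
        a \<noteq> c; a \<noteq> d; a \<noteq> e; b \<noteq> d; b \<noteq> e; c \<noteq> e\<rbrakk> \<Longrightarrow> False"
    and x_nonneg: "0 \<le> x v"
    and x_le_1: "x v \<le> 1"
    and eigen: "v \<in> V \<Longrightarrow> (\<Sum>y\<in>V. of_bool (adj v y) * x y) = \<rho> * x v"
    and u_V: "u \<in> V"
    and x_u: "x u = 1"
    and rho_ge: "\<rho> \<ge> 49/5"
    and size: "(\<Sum>v\<in>V. \<Sum>y\<in>V. of_bool (adj v y)) \<le> 2 * (\<rho>\<^sup>2 - \<rho> + 1)"
begin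

definition N where "N = {v \<in> V. adj u v}"
definition W where "W = V - N - {u}"
definition dN where "dN v = card {y \<in> N. adj v y}"
definition dW where "dW v = card {y \<in> W. adj v y}"
definition sN where "sN v = (\<Sum>y\<in>N. of_bool (adj v y) * x y)"
definition sW where "sW v = (\<Sum>y\<in>W. of_bool (adj v y) * x y)"
definition loss where "loss w = real (dN w) * (1 - x w) + real (dW w) / 2"
definition gain where "gain v = (real (dN v) - 1) * x v - real (dN v) / 2"
text \<open>A leaf pays 1/2 to its neighbour, the neighbours counted here pay nothing; many of them
  are what can make \<open>cost\<close> negative.\<close>

definition inner where "inner v = card {y \<in> N. adj v y \<and> dN y \<ge> 2}"
text \<open>Discharging: every vertex of degree one in \<open>G[N]\<close> has gain \<open>-1/2\<close>, which it passes on to its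
  neighbour if that one has larger degree. The cost is the negative of the resulting charge.\<close>
definition cost where "cost v = (if dN v = 0 then x v
    else if dN v = 1 then (1 - real (inner v)) / 2
    else (real (dN v) - 1) * (1 - x v) + 1 - real (inner v) / 2)"

section \<open>Counting edges and walks from \<open>u\<close>; the budget inequality\<close>

lemma adj_comm: "adj a b \<longleftrightarrow> adj b a"
  using adj_sym by blast

lemma finite_N [simp]: "finite N" and finite_W [simp]: "finite W"
  unfolding N_def W_def using finite_V by auto

lemma V_split: "V = insert u (N \<union> W)" "u \<notin> N" "u \<notin> W" "N \<inter> W = {}"
  unfolding N_def W_def using u_V adj_irrefl by auto

lemma N_adj: "v \<in> N \<longleftrightarrow> adj u v"
  unfolding N_def using adj_V adj_sym by blast

lemma N_not_W: "v \<in> N \<Longrightarrow> v \<notin> W"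
  using V_split by blast

lemma W_not_adj_u: "w \<in> W \<Longrightarrow> \<not> adj u w \<and> \<not> adj w u \<and> w \<noteq> u"
  using N_adj V_split adj_sym by blast

lemma sum_V: "(\<Sum>v\<in>V. f v) = f u + (\<Sum>v\<in>N. f v) + (\<Sum>v\<in>W. f v)" for f :: "'a \<Rightarrow> real"
proof -
  have "(\<Sum>v\<in>V. f v) = f u + (\<Sum>v\<in>N \<union> W. f v)"
    using arg_cong[OF V_split(1), of "sum f"] V_split(2,3) by simp
  also have "(\<Sum>v\<in>N \<union> W. f v) = (\<Sum>v\<in>N. f v) + (\<Sum>v\<in>W. f v)"
    using V_split by (intro sum.union_disjoint) auto
  finally show ?thesis by simp
qed

lemma dN_sum: "real (dN v) = (\<Sum>y\<in>N. of_bool (adj v y))"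
  and dW_sum: "real (dW v) = (\<Sum>y\<in>W. of_bool (adj v y))"
  unfolding dN_def dW_def by (simp_all add: card_filter_of_bool)

lemma swap_adj: "(\<Sum>a\<in>A. \<Sum>b\<in>B. of_bool (adj a b) * f b) = (\<Sum>b\<in>B. (\<Sum>a\<in>A. of_bool (adj b a)) * f b)"
  for f :: "'a \<Rightarrow> real"
  by (subst sum.swap) (simp add: sum_distrib_right adj_comm)

lemma rho_sum: "(\<Sum>v\<in>N. x v) = \<rho>"
proof -
  have "\<rho> = (\<Sum>y\<in>V. of_bool (adj u y) * x y)" using eigen[OF u_V] x_u by simp
  also have "\<dots> = (\<Sum>y\<in>N. of_bool (adj u y) * x y) + (\<Sum>y\<in>W. of_bool (adj u y) * x y)"
    by (subst sum_V) (simp add: adj_irrefl)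
  also have "(\<Sum>y\<in>W. of_bool (adj u y) * x y) = 0"
    using W_not_adj_u by (intro sum.neutral) auto
  also have "(\<Sum>y\<in>N. of_bool (adj u y) * x y) = (\<Sum>y\<in>N. x y)"
    using N_adj by (intro sum.cong) auto
  finally show ?thesis by simp
qed

lemma eigen_N: "v \<in> N \<Longrightarrow> \<rho> * x v = 1 + sN v + sW v"
  using eigen[of v] adj_sym N_adj x_u unfolding sN_def sW_def sum_V N_def by auto

lemma eigen_W: "w \<in> W \<Longrightarrow> \<rho> * x w = sN w + sW w"
  using eigen[of w] W_not_adj_u unfolding sN_def sW_def sum_V by (auto simp: W_def)

text \<open>The neighbour \<open>u\<close> alone contributes 1 to the eigenvalue equation at
  \<open>v\<close>.\<close>

lemma x_N_pos: "v \<in> N \<Longrightarrow> x v > 0"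
proof -
  assume "v \<in> N"
  then have "\<rho> * x v \<ge> 1"
    using eigen_N x_nonneg by (simp add: sN_def sW_def sum_nonneg)
  then show "x v > 0" using rho_ge x_nonneg[of v] by (cases "x v = 0") auto
qed

lemma card_N: "real (card N) \<ge> \<rho>"
  using sum_mono[of N x "\<lambda>_. 1"] x_le_1 rho_sum by simp

lemma size_split:
  "real (card N) + (\<Sum>v\<in>N. real (dN v)) / 2 + (\<Sum>w\<in>W. real (dN w)) + (\<Sum>w\<in>W. real (dW w)) / 2
    \<le> \<rho>\<^sup>2 - \<rho> + 1"
proof -
  have u: "(\<Sum>y\<in>V. of_bool (adj u y)) = real (card N)"
    using finite_V by (simp add: N_def Int_def)
  have "(\<Sum>y\<in>V. of_bool (adj v y)) = 1 + real (dN v) + real (dW v)" if "v \<in> N" for v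
    using that N_adj adj_sym by (simp add: sum_V dN_sum dW_sum)
  then have n: "(\<Sum>v\<in>N. \<Sum>y\<in>V. of_bool (adj v y))
      = real (card N) + (\<Sum>v\<in>N. real (dN v)) + (\<Sum>v\<in>N. real (dW v))"
    by (simp add: sum.distrib)
  have "(\<Sum>y\<in>V. of_bool (adj w y)) = real (dN w) + real (dW w)" if "w \<in> W" for w
    using that W_not_adj_u by (simp add: sum_V dN_sum dW_sum)
  then have w: "(\<Sum>v\<in>W. \<Sum>y\<in>V. of_bool (adj v y))
      = (\<Sum>v\<in>W. real (dN v)) + (\<Sum>v\<in>W. real (dW v))"
    by (simp add: sum.distrib)
  have "(\<Sum>v\<in>N. real (dW v)) = (\<Sum>w\<in>W. real (dN w))"
    using swap_adj[where A = N and B = W and f = "\<lambda>_. 1"] by (simp add: dN_sum dW_sum del: sum_of_bool_eq)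
  with size u n w show ?thesis unfolding sum_V[of "\<lambda>v. \<Sum>y\<in>V. of_bool (adj v y)"] by argo
qed

lemma rho_square:
  "\<rho>\<^sup>2 = real (card N) + (\<Sum>v\<in>N. real (dN v) * x v) + (\<Sum>w\<in>W. real (dN w) * x w)"
proof -
  have "\<rho>\<^sup>2 = (\<Sum>v\<in>N. \<rho> * x v)"
    using rho_sum by (simp add: sum_distrib_left[symmetric] power2_eq_square)
  also have "\<dots> = (\<Sum>v\<in>N. 1 + sN v + sW v)" using eigen_N by simp
  also have "\<dots> = real (card N) + (\<Sum>v\<in>N. sN v) + (\<Sum>v\<in>N. sW v)"
    by (simp add: sum.distrib)
  also have "(\<Sum>v\<in>N. sN v) = (\<Sum>v\<in>N. real (dN v) * x v)"
    unfolding sN_def swap_adj by (simp add: dN_sum del: sum_of_bool_eq)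
  also have "(\<Sum>v\<in>N. sW v) = (\<Sum>w\<in>W. real (dN w) * x w)"
    unfolding sW_def swap_adj by (simp add: dN_sum del: sum_of_bool_eq)
  finally show ?thesis .
qed

text \<open>Combine \<open>size_split\<close> with \<open>rho_square\<close>: \<open>card N\<close>
  cancels, and \<open>\<rho>\<close> is the total weight of \<open>N\<close> by
  \<open>rho_sum\<close>.\<close>

lemma loss_le_gain: "(\<Sum>w\<in>W. loss w) \<le> 1 + (\<Sum>v\<in>N. gain v)"
proof -
  have "(\<Sum>w\<in>W. loss w) = (\<Sum>w\<in>W. real (dN w)) - (\<Sum>w\<in>W. real (dN w) * x w) + (\<Sum>w\<in>W. real (dW w)) / 2"
    by (simp add: loss_def sum.distrib sum_subtractf right_diff_distrib sum_divide_distrib)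
  moreover have "(\<Sum>v\<in>N. gain v) = (\<Sum>v\<in>N. real (dN v) * x v) - \<rho> - (\<Sum>v\<in>N. real (dN v)) / 2"
    using rho_sum by (simp add: gain_def sum_subtractf left_diff_distrib sum_divide_distrib)
  ultimately show ?thesis using size_split rho_square by argo
qed

text \<open>Discharging moves 1/2 along each edge between a leaf and a vertex of larger degree.
  Charge received and charge given count the same edges, so the total is preserved.\<close>

lemma gain_cost: "(\<Sum>v\<in>N. gain v) = - (\<Sum>v\<in>N. cost v)"
proof -
  let ?B = "{v \<in> N. dN v \<ge> 2}" and ?L = "{v \<in> N. dN v = 1}"
  define leaves where "leaves v = card {y \<in> N. adj v y \<and> dN y = 1}" for v
  have dN_eq: "dN v = inner v + leaves v" if "v \<in> N" for v
  proof -
    have "dN y \<ge> 1" if "y \<in> N" "adj v y" for y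
      unfolding dN_def using that \<open>v \<in> N\<close> adj_sym
      by (metis (no_types, lifting) One_nat_def Suc_leI card_gt_0_iff empty_iff finite_N finite_subset mem_Collect_eq subsetI)
    then have "{y \<in> N. adj v y} = {y \<in> N. adj v y \<and> dN y \<ge> 2} \<union> {y \<in> N. adj v y \<and> dN y = 1}"
      by force
    moreover have "card ({y \<in> N. adj v y \<and> dN y \<ge> 2} \<union> {y \<in> N. adj v y \<and> dN y = 1}) = inner v + leaves v"
      unfolding inner_def leaves_def by (rule card_Un_disjoint) auto
    ultimately show ?thesis unfolding dN_def by simp
  qed
  have "gain v + cost v = (if v \<in> ?B then real (leaves v) / 2 else 0) - (if v \<in> ?L then real (inner v) / 2 else 0)"
    if "v \<in> N" for v
  proof -
    have r: "real (dN v) = real (inner v) + real (leaves v)" using dN_eq[OF that] by simp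
    consider "dN v = 0" | "dN v = 1" | "dN v \<ge> 2" by linarith
    then show ?thesis
    proof cases
      case 3
      then have "gain v + cost v = real (dN v) / 2 - real (inner v) / 2"
        by (simp add: gain_def cost_def algebra_simps)
      with 3 that r show ?thesis by (simp add: add_divide_distrib)
    qed (use that in \<open>simp_all add: gain_def cost_def diff_divide_distrib\<close>)
  qed
  then have "(\<Sum>v\<in>N. gain v + cost v) =
      (\<Sum>v\<in>N. if v \<in> ?B then real (leaves v) / 2 else 0) - (\<Sum>v\<in>N. if v \<in> ?L then real (inner v) / 2 else 0)"
    by (simp add: sum_subtractf)
  also have "(\<Sum>v\<in>N. if v \<in> ?B then real (leaves v) / 2 else 0) = (\<Sum>v\<in>N. \<Sum>y\<in>N. of_bool (adj v y \<and> 2 \<le> dN v \<and> dN y = 1) / 2)"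
    by (intro sum.cong refl) (auto simp add: leaves_def card_filter_of_bool sum_divide_distrib simp del: sum_of_bool_eq)
  also have "(\<Sum>v\<in>N. if v \<in> ?L then real (inner v) / 2 else 0) = (\<Sum>v\<in>N. \<Sum>y\<in>N. of_bool (adj v y \<and> 2 \<le> dN y \<and> dN v = 1) / 2)"
    by (intro sum.cong refl) (auto simp add: inner_def card_filter_of_bool sum_divide_distrib simp del: sum_of_bool_eq)
  also have "\<dots> = (\<Sum>v\<in>N. \<Sum>y\<in>N. of_bool (adj v y \<and> 2 \<le> dN v \<and> dN y = 1) / 2)"
    by (subst sum.swap) (intro sum.cong refl, use adj_comm in auto)
  finally show ?thesis by (simp add: sum.distrib)
qed

lemma loss_cost: "(\<Sum>w\<in>W. loss w) + (\<Sum>v\<in>N. cost v) \<le> 1"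
  using loss_le_gain gain_cost by simp

lemma loss_nonneg: "loss w \<ge> 0"
  unfolding loss_def using x_le_1[of w] by simp

section \<open>Components of \<open>G[N]\<close> with vertices of negative cost\<close>

lemma no_P5:
  assumes "a \<in> N" "b \<in> N" "c \<in> N" "d \<in> N" "e \<in> N" "adj a b" "adj b c" "adj c d" "adj d e"
    "a \<noteq> c" "a \<noteq> d" "a \<noteq> e" "b \<noteq> d" "b \<noteq> e" "c \<noteq> e"
  shows False
  using assms no_fan[of u a b c d e] N_adj by blast

lemma other_nbr:
  assumes "dN y \<ge> 2"
  obtains z where "z \<in> N" "adj y z" "z \<noteq> v"
proof -
  have "\<not> {z \<in> N. adj y z} \<subseteq> {v}"
  proof
    assume "{z \<in> N. adj y z} \<subseteq> {v}"
    then have "dN y \<le> card {v}" unfolding dN_def by (intro card_mono) auto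
    with assms show False by simp
  qed
  then show ?thesis using that by blast
qed

lemma dN_ge:
  assumes "S \<subseteq> {z \<in> N. adj y z}"
  shows "card S \<le> dN y"
  unfolding dN_def using assms by (intro card_mono) auto

lemma nbrs_eq:
  assumes "{z \<in> N. adj y z} = S"
  shows "dN y = card S" "sN y = sum x S" "\<forall>z\<in>S. dN z \<ge> 2 \<Longrightarrow> inner y = card S"
proof -
  show "dN y = card S" using assms unfolding dN_def by simp
  have "{z \<in> N. adj y z \<and> dN z \<ge> 2} = S" if "\<forall>z\<in>S. dN z \<ge> 2"
    using that assms by blast
  then show "\<forall>z\<in>S. dN z \<ge> 2 \<Longrightarrow> inner y = card S"
    unfolding inner_def by simp
  show "sN y = sum x S"
    unfolding sN_def assms[symmetric] by (intro sum.mono_neutral_cong_right) auto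
qed

text \<open>The edge \<open>cd\<close> is left open: \<open>K\<^sub>4\<close> and \<open>K\<^sub>4\<close> minus an edge are the only components
  of \<open>G[N]\<close> with vertices of negative cost.\<close>
definition diamond where "diamond a b c d \<longleftrightarrow> a \<in> N \<and> b \<in> N \<and> c \<in> N \<and> d \<in> N \<and>
  adj a b \<and> adj a c \<and> adj a d \<and> adj b c \<and> adj b d \<and> c \<noteq> d"

lemma diamond_flip: "diamond a b c d \<Longrightarrow> diamond b a c d" "diamond a b c d \<Longrightarrow> diamond a b d c"
  unfolding diamond_def using adj_sym by blast+

lemma diamond_distinct:
  assumes "diamond a b c d"
  shows "a \<noteq> b" "a \<noteq> c" "a \<noteq> d" "b \<noteq> c" "b \<noteq> d" "c \<noteq> d"
  using assms adj_irrefl unfolding diamond_def by blast+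

text \<open>A further neighbour in \<open>N\<close> of any of the four vertices would be the end of
  a path on five vertices through the diamond. So the diamond fills a component of
  \<open>G[N]\<close>.\<close>

lemma diamond_closed:
  assumes "diamond a b c d" "z \<in> N"
  shows "adj a z \<Longrightarrow> z \<in> {b, c, d}" "adj b z \<Longrightarrow> z \<in> {a, c, d}"
    "adj c z \<Longrightarrow> z \<in> {a, b, d}" "adj d z \<Longrightarrow> z \<in> {a, b, c}"
proof -
  have 1: "z \<in> {b, c, d}" if "diamond a b c d" "adj a z" for a b c d
  proof (rule ccontr)
    assume *: "z \<notin> {b, c, d}"
    have "a \<noteq> z" using that adj_irrefl by blast
    with * that assms(2) show False
      using no_P5[of z a c b d] diamond_distinct[OF that(1)] adj_sym unfolding diamond_def by blast
  qed
  have 2: "z \<in> {a, b, d}" if "diamond a b c d" "adj c z" for a b c d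
  proof (rule ccontr)
    assume *: "z \<notin> {a, b, d}"
    have "c \<noteq> z" using that adj_irrefl by blast
    with * that assms(2) show False
      using no_P5[of z c a d b] diamond_distinct[OF that(1)] adj_sym unfolding diamond_def by blast
  qed
  show "adj a z \<Longrightarrow> z \<in> {b, c, d}" "adj b z \<Longrightarrow> z \<in> {a, c, d}"
    "adj c z \<Longrightarrow> z \<in> {a, b, d}" "adj d z \<Longrightarrow> z \<in> {a, b, c}"
    using 1 2 assms(1) diamond_flip by blast+
qed

text \<open>Otherwise \<open>a\<close> is the hub of a fan whose path uses \<open>w\<close>, the
  rest of the diamond, and \<open>u\<close>.\<close>

lemma diamond_W:
  assumes "diamond a b c d" "w \<in> W" "adj a w"
  shows "\<not> adj b w" "\<not> adj c w" "\<not> adj d w"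
proof -
  have w: "w \<noteq> a" "w \<noteq> b" "w \<noteq> c" "w \<noteq> d" "w \<noteq> u"
    using assms W_not_adj_u N_not_W unfolding diamond_def by blast+
  have u: "adj u a" "adj u b" "adj u c" "adj u d" "u \<noteq> a" "u \<noteq> b" "u \<noteq> c" "u \<noteq> d"
    using assms(1) N_adj adj_irrefl unfolding diamond_def by metis+
  note * = w u diamond_distinct[OF assms(1)] assms(3) assms(1)[unfolded diamond_def]
  show "\<not> adj b w" using no_fan[of a w b c u d] * adj_sym by metis
  show "\<not> adj c w" using no_fan[of a w c b d u] * adj_sym by metis
  show "\<not> adj d w" using no_fan[of a w d b c u] * adj_sym by metis
qed

text \<open>Take three non-leaf neighbours of \<open>v\<close>. A further neighbour of one of them
  outside the three would complete a path on five vertices, so each of them is adjacent to another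
  one. Three vertices without an isolated one contain a path, whose middle vertex forms the central
  edge of a diamond with \<open>v\<close>.\<close>

lemma inner_gt_2:
  assumes "v \<in> N" "inner v > 2"
  shows "\<exists>b c d. diamond v b c d \<or> diamond b c v d"
proof -
  from assms(2) have "3 \<le> card {y \<in> N. adj v y \<and> dN y \<ge> 2}" unfolding inner_def by simp
  then obtain T where T: "T \<subseteq> {y \<in> N. adj v y \<and> dN y \<ge> 2}" "card T = 3"
    by (meson obtain_subset_with_card_n)
  then obtain b c e where bce: "T = {b, c, e}" "b \<noteq> c" "b \<noteq> e" "c \<noteq> e"
    by (auto simp: card_3_iff)
  have in_N: "b \<in> N" "c \<in> N" "e \<in> N" and va: "adj v b" "adj v c" "adj v e"
    and d2: "dN b \<ge> 2" "dN c \<ge> 2" "dN e \<ge> 2" using T bce by auto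
  have inside: "b' \<in> {c, e}"
    if b': "b' \<in> N" "adj b b'" "b' \<noteq> v" and in_N: "b \<in> N" "c \<in> N" "e \<in> N"
      and va: "adj v b" "adj v c" "adj v e" and d: "b \<noteq> c" "b \<noteq> e" "c \<noteq> e" and d2: "dN c \<ge> 2"
    for b c e b'
  proof (rule ccontr)
    assume out: "b' \<notin> {c, e}"
    obtain c' where c': "c' \<in> N" "adj c c'" "c' \<noteq> v" using other_nbr[OF d2, where v = v] by metis
    have n: "b' \<noteq> b" "c' \<noteq> c" "v \<noteq> b" "v \<noteq> c" "v \<noteq> e" using b' c' va adj_irrefl by metis+
    consider "c' = b'" | "c' = b" | "c' \<noteq> b'" "c' \<noteq> b" by blast
    then show False
    proof cases
      case 1
      then show False using no_P5[of e v b b' c] n out b' c' in_N va d assms(1) adj_sym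
        by (metis insertCI)
    next
      case 2
      then show False using no_P5[of b' b c v e] n out b' c' in_N va d assms(1) adj_sym
        by (metis insertCI)
    next
      case 3
      then show False using no_P5[of b' b v c c'] n out b' c' in_N va d assms(1) adj_sym
        by (metis insertCI)
    qed
  qed
  have nb: "adj b c \<or> adj b e"
    using other_nbr[OF d2(1), of v] inside[of _ b c e] in_N va bce d2 by (metis insertE empty_iff)
  have nc: "adj c b \<or> adj c e"
    using other_nbr[OF d2(2), of v] inside[of _ c b e] in_N va bce d2 by (metis insertE empty_iff)
  have ne: "adj e b \<or> adj e c"
    using other_nbr[OF d2(3), of v] inside[of _ e b c] in_N va bce d2 by (metis insertE empty_iff)
  have "(adj b c \<and> adj b e) \<or> (adj c b \<and> adj c e) \<or> (adj e b \<and> adj e c)"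
    using nb nc ne adj_sym by blast
  then show ?thesis
    unfolding diamond_def using in_N va bce(2-4) assms(1) adj_sym by metis
qed

lemma cost_nonneg:
  assumes "inner v \<le> 2"
  shows "cost v \<ge> 0"
proof -
  have "inner v \<le> dN v" unfolding inner_def dN_def by (intro card_mono) auto
  moreover have "(real (dN v) - 1) * (1 - x v) \<ge> 0" if "dN v \<ge> 1"
    using that x_le_1[of v] by simp
  ultimately show ?thesis using assms x_nonneg[of v] unfolding cost_def by auto
qed

text \<open>The sign of the costs is not yet settled, so this works with gains directly: a
  non-isolated vertex of \<open>G[N]\<close> has gain at most \<open>dN v / 2 - 1\<close>. The four
  vertices of \<open>S\<close> save 4, which limits the edges inside \<open>W\<close> and, with
  \<open>size_split\<close>, all degrees of \<open>W\<close>.\<close>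

lemma sum_W_le:
  assumes "S \<subseteq> N" "card S = 4" "\<forall>v\<in>S. dN v \<ge> 1"
  shows "(\<Sum>w\<in>W. x w) \<le> \<rho> - 2"
proof -
  have "gain v \<le> real (dN v) / 2 - of_bool (v \<in> S)" if "v \<in> N" for v
  proof (cases "dN v = 0")
    case True
    with assms(3) x_nonneg[of v] show ?thesis by (auto simp: gain_def)
  next
    case False
    then have "(real (dN v) - 1) * x v \<le> (real (dN v) - 1) * 1"
      using x_le_1[of v] by (intro mult_left_mono) auto
    then show ?thesis by (simp add: gain_def)
  qed
  then have "(\<Sum>v\<in>N. gain v) \<le> (\<Sum>v\<in>N. real (dN v) / 2 - of_bool (v \<in> S))"
    by (rule sum_mono)
  also have "\<dots> = (\<Sum>v\<in>N. real (dN v)) / 2 - 4"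
    using assms(1,2) by (simp add: sum_subtractf sum_divide_distrib Int_absorb1)
  finally have g: "(\<Sum>v\<in>N. gain v) \<le> (\<Sum>v\<in>N. real (dN v)) / 2 - 4" .
  have "loss w \<ge> real (dW w) / 2" for w using x_le_1[of w] by (simp add: loss_def)
  then have "(\<Sum>w\<in>W. real (dW w)) / 2 \<le> (\<Sum>w\<in>W. loss w)"
    by (simp add: sum_divide_distrib sum_mono)
  with g loss_le_gain have l: "(\<Sum>w\<in>W. real (dW w)) / 2 \<le> (\<Sum>v\<in>N. real (dN v)) / 2 - 3" by simp
  have "\<rho> * (\<Sum>w\<in>W. x w) \<le> (\<Sum>w\<in>W. real (dN w) + real (dW w))"
    unfolding sum_distrib_left
  proof (rule sum_mono)
    fix w assume "w \<in> W"
    have "sN w \<le> real (dN w)" "sW w \<le> real (dW w)"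
      unfolding sN_def sW_def dN_sum dW_sum using x_le_1 by (auto intro!: sum_mono simp: of_bool_def simp del: sum_of_bool_eq)
    then show "\<rho> * x w \<le> real (dN w) + real (dW w)" using eigen_W[OF \<open>w \<in> W\<close>] by simp
  qed
  also have "\<dots> \<le> \<rho> * (\<rho> - 2)"
    using l size_split card_N by (simp add: sum.distrib power2_eq_square algebra_simps)
  finally show ?thesis using rho_ge by simp
qed

text \<open>Vertices of \<open>W\<close> see almost disjoint parts of the diamond, so the weight it
  receives from \<open>W\<close> is bounded by that of \<open>W\<close> itself. The four entries are
  then too small for the cost to fit into the budget.\<close>

lemma cost_diamond:
  assumes D: "diamond a b c d"
  shows "cost a + cost b + cost c + cost d > 1"
proof -
  note dist = diamond_distinct[OF D]
  note cl = diamond_closed[OF D]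
  note D' = D[unfolded diamond_def]
  have na: "{z \<in> N. adj a z} = {b, c, d}" and nb: "{z \<in> N. adj b z} = {a, c, d}"
    using cl(1,2) D' adj_sym by blast+
  have dab: "dN a = 3" "dN b = 3" using nbrs_eq(1)[OF na] nbrs_eq(1)[OF nb] dist by auto
  have dcd: "dN c \<ge> 2" "dN d \<ge> 2"
    using dN_ge[of "{a, b}" c] dN_ge[of "{a, b}" d] D' adj_sym dist by auto
  have iab: "inner a = 3" "inner b = 3"
    using nbrs_eq(3)[OF na] nbrs_eq(3)[OF nb] dist dab dcd by auto
  have "(\<Sum>w\<in>W. x w) \<le> \<rho> - 2"
    using sum_W_le[of "{a, b, c, d}"] D' dist dab dcd by auto
  moreover have sW3: "sW a + sW b + sW z \<le> (\<Sum>w\<in>W. x w)" if "z = c \<or> z = d" for z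
    unfolding sW_def sum.distrib[symmetric]
  proof (rule sum_mono)
    fix w assume "w \<in> W"
    then have "\<not> (adj a w \<and> adj b w)" "\<not> (adj a w \<and> adj z w)" "\<not> (adj b w \<and> adj z w)"
      using that diamond_W[OF D] diamond_W[OF diamond_flip(1)[OF D]] by blast+
    then show "of_bool (adj a w) * x w + of_bool (adj b w) * x w + of_bool (adj z w) * x w \<le> x w"
      using x_nonneg[of w] by (auto simp: of_bool_def)
  qed
  ultimately have T: "sW a + sW b + sW c \<le> \<rho> - 2" "sW a + sW b + sW d \<le> \<rho> - 2"
    by fastforce+
  have ea: "\<rho> * x a = 1 + x b + x c + x d + sW a" "\<rho> * x b = 1 + x a + x c + x d + sW b"
    using eigen_N[of a] eigen_N[of b] nbrs_eq(2)[OF na] nbrs_eq(2)[OF nb] D' dist by auto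
  have cab: "cost a = 2 * (1 - x a) - 1 / 2" "cost b = 2 * (1 - x b) - 1 / 2"
    unfolding cost_def using dab iab by auto
  show ?thesis
  proof (cases "adj c d")
    case False
    have nc: "{z \<in> N. adj c z} = {a, b}" and nd: "{z \<in> N. adj d z} = {a, b}"
      using cl(3,4) D' adj_sym False by blast+
    have ec: "\<rho> * x c = 1 + x a + x b + sW c" "\<rho> * x d = 1 + x a + x b + sW d"
      using eigen_N[of c] eigen_N[of d] nbrs_eq(2)[OF nc] nbrs_eq(2)[OF nd] D' dist by auto
    have "dN c = 2" "dN d = 2" "inner c = 2" "inner d = 2"
      using nbrs_eq[OF nc] nbrs_eq[OF nd] dab dist by auto
    then have ccd: "cost c = 1 - x c" "cost d = 1 - x d" unfolding cost_def by auto
    \<comment> \<open>The total cost is \<open>5 - 2 * (x a + x b) - (x c + x d)\<close>, so this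
      combination must stay below 4. A vertex of \<open>W\<close> may see both \<open>c\<close> and
      \<open>d\<close>; hence the two bounds in \<open>T\<close> are added, which counts
      \<open>a\<close> and \<open>b\<close> twice.\<close>
    have "(\<rho> - 4) * (2 * (x a + x b) + (x c + x d)) \<le>
        2 * (\<rho> - 2) * (x a + x b) + (\<rho> - 4) * (x c + x d)"
      using x_nonneg[of a] x_nonneg[of b] by (simp add: algebra_simps)
    also have "\<dots> \<le> 2 * (\<rho> + 1)"
      using T ea ec by (simp add: algebra_simps)
    also have "2 * (\<rho> + 1) < (\<rho> - 4) * 4" using rho_ge by simp
    finally have "2 * (x a + x b) + (x c + x d) < 4"
      by (rule mult_left_less_imp_less) (use rho_ge in simp)
    then show ?thesis using cab ccd by simp
  next
    case True
    \<comment> \<open>In K4 all four vertices play the same role, a vertex of \<open>W\<close> sees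
      at most one of them, and a single bound suffices. The total cost is 6 minus twice the total
      weight, whence the target 5/2.\<close>
    have K: "diamond c d a b" using D' True dist adj_sym unfolding diamond_def by blast
    have nc: "{z \<in> N. adj c z} = {a, b, d}" and nd: "{z \<in> N. adj d z} = {a, b, c}"
      using cl(3,4) D' adj_sym True by blast+
    have ec: "\<rho> * x c = 1 + x a + x b + x d + sW c" "\<rho> * x d = 1 + x a + x b + x c + sW d"
      using eigen_N[of c] eigen_N[of d] nbrs_eq(2)[OF nc] nbrs_eq(2)[OF nd] D' dist by auto
    have "dN c = 3" "dN d = 3"
      using nbrs_eq(1)[OF nc] nbrs_eq(1)[OF nd] dist by auto
    moreover have "inner c = 3" "inner d = 3"
      using nbrs_eq(3)[OF nc] nbrs_eq(3)[OF nd] dab dist dcd by auto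
    ultimately have ccd: "cost c = 2 * (1 - x c) - 1 / 2" "cost d = 2 * (1 - x d) - 1 / 2"
      unfolding cost_def by auto
    have "sW a + sW b + sW c + sW d \<le> (\<Sum>w\<in>W. x w)"
      unfolding sW_def sum.distrib[symmetric]
    proof (rule sum_mono)
      fix w assume "w \<in> W"
      then have "\<not> (adj a w \<and> adj b w)" "\<not> (adj a w \<and> adj c w)" "\<not> (adj a w \<and> adj d w)"
        "\<not> (adj b w \<and> adj c w)" "\<not> (adj b w \<and> adj d w)" "\<not> (adj c w \<and> adj d w)"
        using diamond_W[OF D] diamond_W[OF diamond_flip(1)[OF D]] diamond_W[OF K] by blast+
      then show "of_bool (adj a w) * x w + of_bool (adj b w) * x w + of_bool (adj c w) * x w
          + of_bool (adj d w) * x w \<le> x w"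
        using x_nonneg[of w] by (auto simp: of_bool_def)
    qed
    then have "sW a + sW b + sW c + sW d \<le> \<rho> - 2" using \<open>(\<Sum>w\<in>W. x w) \<le> \<rho> - 2\<close> by simp
    then have "(\<rho> - 3) * (x a + x b + x c + x d) \<le> \<rho> + 2"
      using ea ec by (simp add: algebra_simps)
    also have "\<dots> < (\<rho> - 3) * (5 / 2)" using rho_ge by simp
    finally have "x a + x b + x c + x d < 5 / 2"
      by (rule mult_left_less_imp_less) (use rho_ge in simp)
    then show ?thesis using cab ccd by simp
  qed
qed

text \<open>Diamonds on different vertex sets are different components of \<open>G[N]\<close>. Each
  costs more than 1, and all vertices outside them have nonnegative cost, so a single diamond
  already exceeds the budget.\<close>

lemma no_diamond: "\<not> diamond a b c d"
proof
  assume "diamond a b c d"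
  \<comment> \<open>Vertex sets instead of labelled quadruples, since one component has several
    labellings.\<close>
  define \<Q> where "\<Q> = {{a, b, c, d} |a b c d. diamond a b c d}"
  have sub: "Q \<subseteq> N" if "Q \<in> \<Q>" for Q using that unfolding \<Q>_def diamond_def by blast
  have closed: "z \<in> Q" if "Q \<in> \<Q>" "y \<in> Q" "z \<in> N" "adj y z" for Q y z
    using that diamond_closed unfolding \<Q>_def by blast
  have conn: "y = z \<or> adj y z \<or> (\<exists>t\<in>Q. adj y t \<and> adj t z)" if "Q \<in> \<Q>" "y \<in> Q" "z \<in> Q" for Q y z
    using that adj_sym unfolding \<Q>_def diamond_def by blast
  have subset: "Q' \<subseteq> Q" if "Q \<in> \<Q>" "Q' \<in> \<Q>" "Q \<inter> Q' \<noteq> {}" for Q Q'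
  proof
    fix z assume z: "z \<in> Q'"
    from that obtain y where y: "y \<in> Q" "y \<in> Q'" by blast
    show "z \<in> Q"
      using conn[OF that(2) y(2) z] closed[OF that(1)] y(1) sub[OF that(2)] z by blast
  qed
  have sumQ: "sum cost Q > 1" if "Q \<in> \<Q>" for Q
  proof -
    from that obtain a b c d where "Q = {a, b, c, d}" and D: "diamond a b c d"
      unfolding \<Q>_def by blast
    then show ?thesis using cost_diamond[OF D] diamond_distinct[OF D] by (simp add: add.assoc)
  qed
  have Q0: "{a, b, c, d} \<in> \<Q>" using \<open>diamond a b c d\<close> unfolding \<Q>_def by blast
  have "finite \<Q>" using sub by (intro finite_subset[of \<Q> "Pow N"]) auto
  have "sum cost (\<Union>\<Q>) = (\<Sum>Q\<in>\<Q>. sum cost Q)"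
  proof (subst sum.Union_disjoint)
    show "\<forall>A\<in>\<Q>. finite A" using sub finite_subset[OF _ finite_N] by blast
    show "\<forall>A\<in>\<Q>. \<forall>B\<in>\<Q>. A \<noteq> B \<longrightarrow> A \<inter> B = {}"
      using subset by (metis Int_commute subset_antisym)
  qed simp
  also have "\<dots> \<ge> sum cost {a, b, c, d}"
    using \<open>finite \<Q>\<close> Q0 sumQ by (intro member_le_sum) (auto intro: order.trans[OF zero_le_one less_imp_le])
  finally have "sum cost (\<Union>\<Q>) > 1"
    using sumQ[OF Q0] by simp
  moreover have "sum cost (N - \<Union>\<Q>) \<ge> 0"
  proof (intro sum_nonneg cost_nonneg)
    fix v assume v: "v \<in> N - \<Union>\<Q>"
    show "inner v \<le> 2"
    proof (rule ccontr)
      assume "\<not> inner v \<le> 2"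
      then obtain b c d where "diamond v b c d \<or> diamond b c v d"
        using inner_gt_2[of v] v by auto
      then have "v \<in> \<Union>\<Q>" unfolding \<Q>_def by blast
      with v show False by simp
    qed
  qed
  moreover have "sum cost N = sum cost (N - \<Union>\<Q>) + sum cost (\<Union>\<Q>)"
    using sub by (intro sum.subset_diff) auto
  moreover have "(\<Sum>w\<in>W. loss w) \<ge> 0" using loss_nonneg by (intro sum_nonneg) auto
  ultimately show False using loss_cost by simp
qed

lemma inner_le_2: "v \<in> N \<Longrightarrow> inner v \<le> 2"
  using inner_gt_2 no_diamond not_le by blast

lemma cost_ge_0: "v \<in> N \<Longrightarrow> cost v \<ge> 0"
  using cost_nonneg inner_le_2 by blast

lemma cost_subset:
  assumes "S \<subseteq> N"
  shows "(\<Sum>w\<in>W. loss w) + sum cost S \<le> 1"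
proof -
  have "sum cost S \<le> sum cost N" using assms cost_ge_0 by (intro sum_mono2) auto
  then show ?thesis using loss_cost by simp
qed

text \<open>If \<open>w\<close> has no neighbour in \<open>W\<close>, then \<open>\<rho> (1 - x w)\<close> is the weight of the vertices of \<open>N\<close> that
  \<open>w\<close> misses, and \<open>dN w\<close> is at least the weight of the others. The product of the two is smallest
  at the ends of the admissible range.\<close>
lemma loss_ge:
  assumes w: "w \<in> W" and y: "y \<in> N" "adj w y"
    and T: "T \<subseteq> N" "\<And>t. t \<in> T \<Longrightarrow> \<not> adj w t"
    and \<mu>: "0 \<le> \<mu>" "\<mu> \<le> 1/2" "\<mu> \<le> sum x T"
  shows "9/10 * \<mu> \<le> loss w"
proof (cases "dW w = 0")
  case False
  \<comment> \<open>A neighbour inside \<open>W\<close> already causes a loss of 1/2.\<close>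
  have "real (dN w) * (1 - x w) \<ge> 0" using x_le_1[of w] by simp
  with False \<mu> show ?thesis by (simp add: loss_def)
next
  case True
  define b where "b = real (dN w)"
  define M where "M = \<rho> - sN w"
  have "sW w \<le> real (dW w)"
    unfolding sW_def dW_sum using x_le_1 by (auto intro!: sum_mono simp: of_bool_def simp del: sum_of_bool_eq)
  moreover have "sW w \<ge> 0" unfolding sW_def using x_nonneg by (simp add: sum_nonneg)
  ultimately have "sW w = 0" using True by simp
  then have M: "\<rho> * (1 - x w) = M" using eigen_W[OF w] by (simp add: M_def algebra_simps)
  have b_ge: "b \<ge> \<rho> - M"
    unfolding b_def M_def sN_def dN_sum
    using x_le_1 by (auto intro!: sum_mono simp: of_bool_def simp del: sum_of_bool_eq)
  have b1: "b \<ge> 1" using dN_ge[of "{y}" w] y by (simp add: b_def)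
  have "M = (\<Sum>v\<in>N. of_bool (\<not> adj w v) * x v)"
    unfolding M_def rho_sum[symmetric] sN_def sum_subtractf[symmetric] by (intro sum.cong) auto
  also have "\<dots> \<ge> (\<Sum>v\<in>T. of_bool (\<not> adj w v) * x v)"
    using T(1) x_nonneg by (intro sum_mono2) auto
  also have "(\<Sum>v\<in>T. of_bool (\<not> adj w v) * x v) = sum x T" using T(2) by (intro sum.cong) auto
  finally have \<mu>M: "\<mu> \<le> M" using \<mu> by simp
  have "\<mu> * (\<rho> - \<mu>) \<le> b * M"
  proof (cases "b \<ge> \<rho> - \<mu>")
    case True
    then have "(\<rho> - \<mu>) * \<mu> \<le> b * M" using \<mu>M \<mu> rho_ge by (intro mult_mono) auto
    then show ?thesis by (simp add: mult.commute)
  next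
    case False
    then have "(b - \<mu>) * (\<rho> - b - \<mu>) \<ge> 0" using b1 \<mu> by simp
    then have "\<mu> * (\<rho> - \<mu>) \<le> b * (\<rho> - b)" by (simp add: algebra_simps)
    also have "\<dots> \<le> b * M" using b_ge b1 by (intro mult_left_mono) auto
    finally show ?thesis .
  qed
  \<comment> \<open>Origin of the factor 9/10: \<open>\<mu> \<le> 1/2\<close> is at most a tenth of
    \<open>\<rho>\<close>.\<close>
  moreover have "\<rho> * (9/10 * \<mu>) \<le> \<mu> * (\<rho> - \<mu>)"
  proof -
    have "\<mu> * (9/10 * \<rho>) \<le> \<mu> * (\<rho> - \<mu>)" using \<mu> rho_ge by (intro mult_left_mono) auto
    then show ?thesis by (simp only: mult.left_commute mult.commute)
  qed
  moreover have "b * M = \<rho> * loss w"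
    using True unfolding M[symmetric] loss_def b_def by simp
  ultimately have "\<rho> * (9/10 * \<mu>) \<le> \<rho> * loss w" by linarith
  then show ?thesis using rho_ge by simp
qed

text \<open>Double counting of the edges between \<open>S\<close> and \<open>W\<close>:
  \<open>K\<close> is the number of edges that a unit of loss buys, and \<open>k\<close> covers one
  exceptional vertex \<open>w0\<close>.\<close>

lemma sum_sW_le:
  assumes "finite S" "K \<ge> 0" "k \<ge> 0"
    and "\<And>w. w \<in> W \<Longrightarrow> real (card {z \<in> S. adj z w}) \<le> K * loss w + (if w = w0 then k else 0)"
  shows "(\<Sum>z\<in>S. sW z) \<le> K * (\<Sum>w\<in>W. loss w) + k"
proof -
  have "(\<Sum>z\<in>S. sW z) \<le> (\<Sum>z\<in>S. \<Sum>w\<in>W. of_bool (adj z w))"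
    unfolding sW_def using x_le_1 by (auto intro!: sum_mono simp: of_bool_def simp del: sum_of_bool_eq)
  also have "\<dots> = (\<Sum>w\<in>W. real (card {z \<in> S. adj z w}))"
    using assms(1) by (subst sum.swap) (simp add: card_filter_of_bool del: sum_of_bool_eq)
  also have "\<dots> \<le> (\<Sum>w\<in>W. K * loss w + (if w = w0 then k else 0))"
    using assms(4) by (rule sum_mono)
  also have "\<dots> \<le> K * (\<Sum>w\<in>W. loss w) + k"
    using assms(3) by (simp add: sum.distrib sum_distrib_left)
  finally show ?thesis .
qed

section \<open>Excluding four-cycles and triangles in \<open>G[N]\<close>\<close>

definition four_cycle where "four_cycle a b c d \<longleftrightarrow> a \<in> N \<and> b \<in> N \<and> c \<in> N \<and> d \<in> N \<and>
  adj a b \<and> adj b c \<and> adj c d \<and> adj d a \<and> a \<noteq> c \<and> b \<noteq> d"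

lemma four_cycle_rotate: "four_cycle a b c d \<Longrightarrow> four_cycle b c d a"
  unfolding four_cycle_def by blast

lemma four_cycle_distinct:
  assumes "four_cycle a b c d"
  shows "a \<noteq> b" "a \<noteq> c" "a \<noteq> d" "b \<noteq> c" "b \<noteq> d" "c \<noteq> d"
  using assms adj_irrefl unfolding four_cycle_def by blast+

text \<open>A chord gives a diamond, an outside neighbour a path on five vertices.\<close>

lemma four_cycle_nbrs:
  assumes "four_cycle a b c d"
  shows "{z \<in> N. adj a z} = {b, d}"
proof -
  note C = assms[unfolded four_cycle_def]
  have "\<not> adj a c" using no_diamond[of a c b d] C adj_sym unfolding diamond_def by blast
  moreover have "z \<in> {b, c, d}" if "z \<in> N" "adj a z" for z
  proof (rule ccontr)
    assume "z \<notin> {b, c, d}"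
    then show False using no_P5[of z a b c d] that C four_cycle_distinct[OF assms] adj_sym by blast
  qed
  ultimately show ?thesis using C adj_sym by blast
qed

text \<open>Every set of three cycle vertices contains one of the pairs excluded here. So at most
  one vertex of \<open>W\<close> sees more than two vertices of the cycle.\<close>

lemma four_cycle_W:
  assumes C: "four_cycle a b c d" and w: "w \<in> W" "w' \<in> W" "w \<noteq> w'"
    and adj_w: "adj d w" "adj a w" "adj b w"
  shows "\<not> (adj a w' \<and> adj b w')" "\<not> (adj a w' \<and> adj d w')" "\<not> (adj b w' \<and> adj c w')"
proof -
  have n: "w \<noteq> a" "w \<noteq> b" "w \<noteq> c" "w \<noteq> d" "w \<noteq> u" "w' \<noteq> a" "w' \<noteq> b" "w' \<noteq> c" "w' \<noteq> d" "w' \<noteq> u"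
    using w W_not_adj_u N_not_W C unfolding four_cycle_def by blast+
  have u: "adj u a" "adj u b" "adj u c" "adj u d" "u \<noteq> a" "u \<noteq> b" "u \<noteq> c" "u \<noteq> d"
    using C N_adj adj_irrefl unfolding four_cycle_def by metis+
  note * = n u w adj_w four_cycle_distinct[OF C] C[unfolded four_cycle_def]
  show "\<not> (adj a w' \<and> adj b w')" using no_fan[of a w' b w d u] * adj_sym by metis
  show "\<not> (adj a w' \<and> adj d w')" using no_fan[of a w' d w b u] * adj_sym by metis
  show "\<not> (adj b w' \<and> adj c w')" using no_fan[of b w a u c w'] * adj_sym by metis
qed

text \<open>A cycle vertex costs one minus its weight, so the total weight is at least 3, and the
  summed eigenvalue equations demand \<open>3 * \<rho> - 10\<close> from \<open>W\<close>. With one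
  exception, vertices of \<open>W\<close> see at most two cycle vertices and lose for it, so the
  supply is bounded by a constant.\<close>

lemma no_four_cycle: "\<not> four_cycle a b c d"
proof
  assume C: "four_cycle a b c d"
  note C2 = four_cycle_rotate[OF C]
  note C3 = four_cycle_rotate[OF C2]
  note C4 = four_cycle_rotate[OF C3]
  note dist = four_cycle_distinct[OF C]
  note nb = four_cycle_nbrs[OF C] four_cycle_nbrs[OF C2] four_cycle_nbrs[OF C3] four_cycle_nbrs[OF C4]
  have in_N: "a \<in> N" "b \<in> N" "c \<in> N" "d \<in> N" using C unfolding four_cycle_def by blast+
  let ?S = "x a + x b + x c + x d"
  have d2: "dN a = 2" "dN b = 2" "dN c = 2" "dN d = 2"
    using nb[THEN nbrs_eq(1)] dist by auto
  moreover have "inner a = 2" "inner b = 2" "inner c = 2" "inner d = 2"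
    using nb[THEN nbrs_eq(3)] d2 dist by auto
  ultimately have "cost a = 1 - x a" "cost b = 1 - x b" "cost c = 1 - x c" "cost d = 1 - x d"
    unfolding cost_def by auto
  then have lossS: "(\<Sum>w\<in>W. loss w) + (4 - ?S) \<le> 1"
    using cost_subset[of "{a, b, c, d}"] in_N dist by (simp add: algebra_simps)
  have loss0: "(\<Sum>w\<in>W. loss w) \<ge> 0" using loss_nonneg by (intro sum_nonneg) auto
  have e: "\<rho> * x a = 1 + x b + x d + sW a" "\<rho> * x b = 1 + x c + x a + sW b"
    "\<rho> * x c = 1 + x d + x b + sW c" "\<rho> * x d = 1 + x a + x c + sW d"
    using in_N[THEN eigen_N] nb[THEN nbrs_eq(2)] dist by auto
  have "(\<rho> - 2) * ?S = 4 + (sW a + sW b + sW c + sW d)" using e by (simp add: algebra_simps)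
  moreover have "(\<rho> - 2) * 3 \<le> (\<rho> - 2) * ?S"
    using lossS loss0 rho_ge by (intro mult_left_mono) auto
  ultimately have big: "sW a + sW b + sW c + sW d \<ge> 3 * \<rho> - 10" by simp
  let ?Q = "{a, b, c, d}"
  have card_Q: "real (card {z \<in> ?Q. adj z w}) = of_bool (adj a w) + of_bool (adj b w) + of_bool (adj c w) + of_bool (adj d w)" for w
    by (subst card_filter_of_bool) (use dist in \<open>simp_all add: add.assoc del: sum_of_bool_eq\<close>)
  have uniq: "w = w'" if "w \<in> W" "w' \<in> W" and 3: "card {z \<in> ?Q. adj z w} > 2" "card {z \<in> ?Q. adj z w'} > 2" for w w'
  proof (rule ccontr)
    assume "w \<noteq> w'"
    note n = four_cycle_W[OF C that(1,2) this] four_cycle_W[OF C2 that(1,2) this]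
      four_cycle_W[OF C3 that(1,2) this] four_cycle_W[OF C4 that(1,2) this]
    have "adj d w \<and> adj a w \<and> adj b w \<or> adj a w \<and> adj b w \<and> adj c w
        \<or> adj b w \<and> adj c w \<and> adj d w \<or> adj c w \<and> adj d w \<and> adj a w"
      if "card {z \<in> ?Q. adj z w} > 2" for w
    proof -
      have "of_bool (adj a w) + of_bool (adj b w) + of_bool (adj c w) + of_bool (adj d w) > (2::real)"
        using that card_Q[of w] by linarith
      then show ?thesis
        by (cases "adj a w"; cases "adj b w"; cases "adj c w"; cases "adj d w") simp_all
    qed
    from this[OF 3(1)] this[OF 3(2)] show False using n by blast
  qed
  have "\<exists>w0. \<forall>w\<in>W. card {z \<in> ?Q. adj z w} > 2 \<longrightarrow> w = w0"
  proof (cases "\<exists>w1\<in>W. card {z \<in> ?Q. adj z w1} > 2")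
    case True
    then obtain w1 where "w1 \<in> W" "card {z \<in> ?Q. adj z w1} > 2" by blast
    then show ?thesis using uniq by blast
  qed blast
  then obtain w0 where w0: "\<And>w. w \<in> W \<Longrightarrow> card {z \<in> ?Q. adj z w} > 2 \<Longrightarrow> w = w0" by blast
  \<comment> \<open>A vertex seeing one or two cycle vertices misses weight at least 1/2 and loses
    at least 9/20; \<open>40/9\<close> is 2 divided by 9/20. The summand 4 is for
    \<open>w0\<close>.\<close>
  have "(\<Sum>z\<in>?Q. sW z) \<le> 40/9 * (\<Sum>w\<in>W. loss w) + 4"
  proof (rule sum_sW_le[where ?w0.0 = w0])
    fix w assume w: "w \<in> W"
    let ?c = "card {z \<in> ?Q. adj z w}"
    show "real ?c \<le> 40/9 * loss w + (if w = w0 then 4 else 0)"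
    proof (cases "?c > 2")
      case True
      have "real ?c \<le> 4" unfolding card_Q by (simp add: of_bool_def)
      then show ?thesis using w0[OF w True] loss_nonneg[of w] by simp
    next
      case False
      show ?thesis
      proof (cases "?c = 0")
        case True
        moreover have "(if w = w0 then 4 else 0) \<ge> (0::real)" by simp
        ultimately show ?thesis using loss_nonneg[of w] by linarith
      next
        case c0: False
        then obtain y where y: "y \<in> ?Q" "adj y w" by (metis (mono_tags, lifting) card.empty empty_Collect_eq)
        let ?T = "{z \<in> ?Q. \<not> adj w z}"
        have "?S = sum x ?Q" using dist by (simp add: add.assoc)
        also have "\<dots> = sum x ?T + sum x {z \<in> ?Q. adj z w}"
          by (subst sum.union_disjoint[symmetric]) (auto simp: adj_comm intro!: sum.cong)
        also have "sum x {z \<in> ?Q. adj z w} \<le> real ?c"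
          using sum_mono[of "{z \<in> ?Q. adj z w}" x "\<lambda>_. 1"] x_le_1 by simp
        finally have "sum x ?T \<ge> 1/2" using False lossS loss0 by linarith
        then have "9/10 * (1/2) \<le> loss w"
          using y in_N adj_sym by (intro loss_ge[OF w, of y ?T]) auto
        moreover have "(if w = w0 then 4 else 0) \<ge> (0::real)" by simp
        ultimately show ?thesis using False by linarith
      qed
    qed
  qed auto
  then have "sW a + sW b + sW c + sW d \<le> 40/9 * (\<Sum>w\<in>W. loss w) + 4"
    using dist by (simp add: add.assoc)
  moreover have "(\<Sum>w\<in>W. loss w) \<le> 1" using lossS x_le_1[of a] x_le_1[of b] x_le_1[of c] x_le_1[of d] by simp
  ultimately show False using big rho_ge by linarith
qed

text \<open>As for four-cycles, except that a vertex of \<open>W\<close> may miss only one light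
  vertex, so its guaranteed loss is of order \<open>1 / \<rho>\<close>. The supply from
  \<open>W\<close> then grows like \<open>20/27 * \<rho>\<close>, still slower than the demand
  \<open>2 * \<rho> - 7\<close>.\<close>

lemma no_triangle_component:
  assumes in_N: "a \<in> N" "b \<in> N" "c \<in> N" and dist: "a \<noteq> b" "b \<noteq> c" "a \<noteq> c"
    and nb: "{z \<in> N. adj a z} = {b, c}" "{z \<in> N. adj b z} = {a, c}" "{z \<in> N. adj c z} = {a, b}"
  shows False
proof -
  let ?S = "x a + x b + x c" and ?Q = "{a, b, c}"
  have d2: "dN a = 2" "dN b = 2" "dN c = 2"
    using nb[THEN nbrs_eq(1)] dist by auto
  moreover have "inner a = 2" "inner b = 2" "inner c = 2"
    using nb[THEN nbrs_eq(3)] d2 dist by auto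
  ultimately have "cost a = 1 - x a" "cost b = 1 - x b" "cost c = 1 - x c"
    unfolding cost_def by auto
  then have lossS: "(\<Sum>w\<in>W. loss w) + (3 - ?S) \<le> 1"
    using cost_subset[of ?Q] in_N dist by (simp add: algebra_simps)
  have loss0: "(\<Sum>w\<in>W. loss w) \<ge> 0" using loss_nonneg by (intro sum_nonneg) auto
  have e: "\<rho> * x a = 1 + x b + x c + sW a" "\<rho> * x b = 1 + x a + x c + sW b"
    "\<rho> * x c = 1 + x a + x b + sW c"
    using in_N[THEN eigen_N] nb[THEN nbrs_eq(2)] dist by auto
  have "(\<rho> - 2) * ?S = 3 + (sW a + sW b + sW c)" using e by (simp add: algebra_simps)
  moreover have "(\<rho> - 2) * 2 \<le> (\<rho> - 2) * ?S"
    using lossS loss0 rho_ge by (intro mult_left_mono) auto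
  ultimately have big: "sW a + sW b + sW c \<ge> 2 * \<rho> - 7" by simp
  \<comment> \<open>Adding \<open>x z\<close> to the eigenvalue equation at \<open>z\<close> gives
    \<open>(\<rho> + 1) * x z = 1 + ?S + sW z\<close>, and the budget forces
    \<open>?S \<ge> 2\<close>.\<close>
  define \<mu> where "\<mu> = 3 / (\<rho> + 1)"
  have \<mu>: "0 < \<mu>" "\<mu> \<le> 1/2" unfolding \<mu>_def using rho_ge by (auto simp: field_simps)
  have x_ge: "x z \<ge> \<mu>" if "z \<in> ?Q" for z
  proof -
    have "sW z \<ge> 0" unfolding sW_def using x_nonneg by (simp add: sum_nonneg)
    then have "(\<rho> + 1) * x z \<ge> 1 + ?S" using that e by (auto simp: algebra_simps)
    then have "(\<rho> + 1) * x z \<ge> 3" using lossS loss0 by linarith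
    then show ?thesis unfolding \<mu>_def using rho_ge by (simp add: field_simps)
  qed
  have uniq: "w = w'" if w: "w \<in> W" "w' \<in> W" and adj: "\<forall>z\<in>?Q. adj z w" "\<forall>z\<in>?Q. adj z w'" for w w'
  proof (rule ccontr)
    assume "w \<noteq> w'"
    moreover have "w \<noteq> b" "w \<noteq> c" "w \<noteq> u" "w' \<noteq> b" "w' \<noteq> c" "w' \<noteq> u" "b \<noteq> u"
      using w in_N W_not_adj_u N_not_W N_adj adj_irrefl by metis+
    moreover have "adj a b" "adj a c" using nb(1) by blast+
    ultimately show False using no_fan[of a w b w' c u] adj in_N N_adj adj_sym dist by (metis insertCI)
  qed
  have "\<exists>w0. \<forall>w\<in>W. (\<forall>z\<in>?Q. adj z w) \<longrightarrow> w = w0"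
  proof (cases "\<exists>w1\<in>W. \<forall>z\<in>?Q. adj z w1")
    case True
    then obtain w1 where "w1 \<in> W" "\<forall>z\<in>?Q. adj z w1" by blast
    then show ?thesis using uniq by blast
  qed blast
  then obtain w0 where w0: "\<And>w. w \<in> W \<Longrightarrow> \<forall>z\<in>?Q. adj z w \<Longrightarrow> w = w0" by blast
  \<comment> \<open>The coefficient is 2 divided by the guaranteed loss \<open>9/10 * \<mu>\<close>;
    3 is for the vertex joined to the whole triangle.\<close>
  have "(\<Sum>z\<in>?Q. sW z) \<le> 20 / (9 * \<mu>) * (\<Sum>w\<in>W. loss w) + 3"
  proof (rule sum_sW_le[where ?w0.0 = w0])
    fix w assume w: "w \<in> W"
    let ?c = "card {z \<in> ?Q. adj z w}"
    have c: "real ?c = of_bool (adj a w) + of_bool (adj b w) + of_bool (adj c w)"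
      by (subst card_filter_of_bool) (use dist in \<open>simp_all add: add.assoc del: sum_of_bool_eq\<close>)
    have K0: "20 / (9 * \<mu>) * loss w \<ge> 0" using loss_nonneg[of w] \<mu> by simp
    consider "\<forall>z\<in>?Q. adj z w" | "\<forall>z\<in>?Q. \<not> adj z w"
      | y t where "y \<in> ?Q" "adj y w" "t \<in> ?Q" "\<not> adj t w" by blast
    then show "real ?c \<le> 20 / (9 * \<mu>) * loss w + (if w = w0 then 3 else 0)"
    proof cases
      case 1
      then show ?thesis using w0[OF w] c K0 by auto
    next
      case 2
      then have "real ?c = 0" unfolding c by simp
      moreover have "(if w = w0 then 3 else 0) \<ge> (0::real)" by simp
      ultimately show ?thesis using K0 by linarith
    next
      case 3
      have "9/10 * \<mu> \<le> loss w"
        using 3 in_N adj_sym x_ge \<mu> by (intro loss_ge[OF w, of y "{t}"]) auto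
      then have "20 / (9 * \<mu>) * (9/10 * \<mu>) \<le> 20 / (9 * \<mu>) * loss w" using \<mu> by (intro mult_left_mono) auto
      then have "2 \<le> 20 / (9 * \<mu>) * loss w" using \<mu> by simp
      moreover have "real ?c \<le> 2" unfolding c using 3 by auto
      moreover have "(if w = w0 then 3 else 0) \<ge> (0::real)" by simp
      ultimately show ?thesis by linarith
    qed
  qed (use \<mu> in auto)
  also have "20 / (9 * \<mu>) * (\<Sum>w\<in>W. loss w) \<le> 20 / (9 * \<mu>) * 1"
    using lossS x_le_1[of a] x_le_1[of b] x_le_1[of c] \<mu> by (intro mult_left_mono) auto
  also have "20 / (9 * \<mu>) * 1 = 20 * (\<rho> + 1) / 27" unfolding \<mu>_def using rho_ge by simp
  finally have "sW a + sW b + sW c \<le> 20 * (\<rho> + 1) / 27 + 3"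
    using dist by (simp add: add.assoc)
  then show False using big rho_ge by argo
qed

text \<open>The pendant edge raises the degree of \<open>a\<close> to at least three, so
  \<open>1 - x a\<close> is charged at least twice and \<open>x a \<ge> 1/2\<close>. A vertex of
  \<open>W\<close> that sees \<open>b\<close> or \<open>c\<close> must miss \<open>a\<close>, so
  every such vertex loses and none is exceptional. The demand \<open>\<rho> - 5\<close> exceeds the
  supply \<open>40/9\<close>.\<close>

lemma no_pendant_triangle:
  assumes in_N: "a \<in> N" "b \<in> N" "c \<in> N" "d \<in> N"
    and adj: "adj a b" "adj b c" "adj a c" "adj a d" and d: "d \<noteq> b" "d \<noteq> c"
  shows False
proof -
  have dist: "a \<noteq> b" "b \<noteq> c" "a \<noteq> c" "a \<noteq> d" using adj adj_irrefl by blast+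
  have nbr: "{z \<in> N. adj b z} = {a, c}"
    if "b \<in> N" "c \<in> N" "adj a b" "adj b c" "adj a c" "d \<noteq> b" "d \<noteq> c" "a \<noteq> b" "b \<noteq> c" "a \<noteq> c" for b c
  proof -
    have "\<not> adj b d" using no_diamond[of a b c d] that in_N adj(4) unfolding diamond_def by blast
    moreover have "z \<in> {a, c, d}" if z: "z \<in> N" "adj b z" for z
    proof (rule ccontr)
      assume "z \<notin> {a, c, d}"
      moreover have "z \<noteq> b" using z adj_irrefl by blast
      ultimately show False using no_P5[of d a c b z] z that in_N \<open>a \<noteq> d\<close> adj(4) adj_sym
        \<open>b \<in> N\<close> \<open>c \<in> N\<close> \<open>adj a b\<close> \<open>adj b c\<close> \<open>adj a c\<close> \<open>d \<noteq> b\<close> \<open>d \<noteq> c\<close> \<open>a \<noteq> b\<close> \<open>b \<noteq> c\<close> by blast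
    qed
    ultimately show ?thesis using that in_N adj_sym by blast
  qed
  have nb: "{z \<in> N. adj b z} = {a, c}" and nc: "{z \<in> N. adj c z} = {a, b}"
    using nbr[of b c] nbr[of c b] in_N adj d dist adj_sym by blast+
  have dbc: "dN b = 2" "dN c = 2" using nb[THEN nbrs_eq(1)] nc[THEN nbrs_eq(1)] dist by auto
  have da: "dN a \<ge> 3" using dN_ge[of "{b, c, d}" a] in_N adj d dist by auto
  have "inner b = 2" "inner c = 2"
    using nb[THEN nbrs_eq(3)] nc[THEN nbrs_eq(3)] dbc da dist by auto
  then have cbc: "cost b = 1 - x b" "cost c = 1 - x c" using dbc unfolding cost_def by auto
  have "2 * (1 - x a) \<le> (real (dN a) - 1) * (1 - x a)"
    using da x_le_1[of a] by (intro mult_right_mono) auto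
  then have ca: "cost a \<ge> 2 * (1 - x a)"
    using da inner_le_2[OF in_N(1)] unfolding cost_def by auto
  have lossS: "(\<Sum>w\<in>W. loss w) + (2 * (1 - x a) + (1 - x b) + (1 - x c)) \<le> 1"
    using cost_subset[of "{a, b, c}"] in_N dist ca cbc by simp
  have loss0: "(\<Sum>w\<in>W. loss w) \<ge> 0" using loss_nonneg by (intro sum_nonneg) auto
  have e: "\<rho> * x b = 1 + x a + x c + sW b" "\<rho> * x c = 1 + x a + x b + sW c"
    using in_N[THEN eigen_N] nb[THEN nbrs_eq(2)] nc[THEN nbrs_eq(2)] dist by auto
  have "(\<rho> - 1) * 1 \<le> (\<rho> - 1) * (x b + x c)"
    using lossS loss0 x_le_1[of a] rho_ge by (intro mult_left_mono) auto
  then have big: "sW b + sW c \<ge> \<rho> - 5"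
    using e x_le_1[of a] by (simp add: algebra_simps)
  have not_a: "\<not> adj a w" if w: "w \<in> W" "adj z w" "z = b \<or> z = c" for w z
  proof
    assume "adj a w"
    moreover have "w \<noteq> b" "w \<noteq> c" "w \<noteq> d" "w \<noteq> u" "u \<noteq> b" "u \<noteq> c"
      using w in_N W_not_adj_u N_not_W N_adj adj_irrefl by metis+
    ultimately show False
      using no_fan[of a w b c u d] no_fan[of a w c b u d] w adj d dist in_N N_adj adj_sym by metis
  qed
  have "(\<Sum>z\<in>{b, c}. sW z) \<le> 40/9 * (\<Sum>w\<in>W. loss w) + 0"
  proof (rule sum_sW_le)
    fix w assume w: "w \<in> W"
    let ?c = "card {z \<in> {b, c}. adj z w}"
    have c: "real ?c = of_bool (adj b w) + of_bool (adj c w)"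
      by (subst card_filter_of_bool) (use dist in \<open>simp_all del: sum_of_bool_eq\<close>)
    show "real ?c \<le> 40/9 * loss w + (if w = u then 0 else 0)"
    proof (cases "adj b w \<or> adj c w")
      case True
      then obtain z where z: "z = b \<or> z = c" "adj z w" by blast
      have "x a \<ge> 1/2" using lossS loss0 x_le_1[of b] x_le_1[of c] by argo
      then have "9/10 * (1/2) \<le> loss w"
        using z in_N not_a[OF w z(2,1)] adj_sym by (intro loss_ge[OF w, of z "{a}"]) auto
      moreover have "real ?c \<le> 2" using c by auto
      ultimately show ?thesis by simp
    next
      case False
      then have "real ?c = 0" unfolding c by simp
      then show ?thesis using loss_nonneg[of w] unfolding if_cancel by linarith
    qed
  qed auto
  then have "sW b + sW c \<le> 40/9 * (\<Sum>w\<in>W. loss w)" using dist by simp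
  moreover have "(\<Sum>w\<in>W. loss w) \<le> 1" using lossS x_le_1[of a] x_le_1[of b] x_le_1[of c] by simp
  ultimately show False using big rho_ge by linarith
qed

lemma no_triangle:
  assumes in_N: "a \<in> N" "b \<in> N" "c \<in> N" and adj: "adj a b" "adj b c" "adj a c"
  shows False
proof -
  have dist: "a \<noteq> b" "b \<noteq> c" "a \<noteq> c" using adj adj_irrefl by blast+
  have "z \<in> {b, c}" if "z \<in> N" "adj a z" for z
    using no_pendant_triangle[of a b c z] in_N adj that by blast
  moreover have "z \<in> {a, c}" if "z \<in> N" "adj b z" for z
    using no_pendant_triangle[of b a c z] in_N adj that adj_sym by blast
  moreover have "z \<in> {a, b}" if "z \<in> N" "adj c z" for z
    using no_pendant_triangle[of c a b z] in_N adj that adj_sym by blast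
  ultimately have "{z \<in> N. adj a z} = {b, c}" "{z \<in> N. adj b z} = {a, c}" "{z \<in> N. adj c z} = {a, b}"
    using in_N adj adj_sym by blast+
  then show False using no_triangle_component[of a b c] in_N dist by blast
qed

section \<open>The extremal configuration\<close>

text \<open>Two non-leaf neighbours of \<open>v\<close> have further neighbours: if these coincide
  they close a four-cycle, otherwise they end a path on five vertices with middle
  \<open>v\<close>.\<close>

lemma inner_le_1:
  assumes "v \<in> N"
  shows "inner v \<le> 1"
proof (rule ccontr)
  assume "\<not> inner v \<le> 1"
  then have "2 \<le> card {y \<in> N. adj v y \<and> dN y \<ge> 2}" unfolding inner_def by simp
  then obtain T where "T \<subseteq> {y \<in> N. adj v y \<and> dN y \<ge> 2}" "card T = 2"
    by (meson obtain_subset_with_card_n)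
  then obtain b c where bc: "b \<in> N" "c \<in> N" "adj v b" "adj v c" "dN b \<ge> 2" "dN c \<ge> 2" "b \<noteq> c"
    by (auto simp: card_2_iff)
  obtain b' where b': "b' \<in> N" "adj b b'" "b' \<noteq> v" using other_nbr[OF bc(5), where v = v] by metis
  obtain c' where c': "c' \<in> N" "adj c c'" "c' \<noteq> v" using other_nbr[OF bc(6), where v = v] by metis
  have nbc: "\<not> adj b c" using no_triangle[of v b c] bc assms by blast
  show False
  proof (cases "b' = c'")
    case True
    then show False
      using no_four_cycle[of v b b' c] bc b' c' assms adj_sym unfolding four_cycle_def by blast
  next
    case False
    then show False
      using no_P5[of b' b v c c'] bc b' c' nbc assms adj_sym by metis
  qed
qed

text \<open>With degrees at most two, \<open>2 * cost v - 2 * gain v\<close> dominates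
  \<open>x v\<close> pointwise. As the gains sum to minus the costs, the total weight
  \<open>\<rho>\<close> of \<open>N\<close> would be at most four times the budget.\<close>

lemma ex_branch: "\<exists>a\<in>N. dN a \<ge> 3"
proof (rule ccontr)
  assume "\<not> (\<exists>a\<in>N. dN a \<ge> 3)"
  then have d: "dN v = 0 \<or> dN v = 1 \<or> dN v = 2" if "v \<in> N" for v using that by force
  have "x v \<le> 2 * cost v - 2 * gain v" if "v \<in> N" for v
  proof -
    have "real (inner v) \<le> 1" using inner_le_1[OF that] by simp
    with d[OF that] x_le_1[of v] x_nonneg[of v] show ?thesis
      unfolding cost_def gain_def by (auto simp: field_simps)
  qed
  then have "\<rho> \<le> (\<Sum>v\<in>N. 2 * cost v - 2 * gain v)"
    unfolding rho_sum[symmetric] by (rule sum_mono)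
  also have "\<dots> = 4 * (\<Sum>v\<in>N. cost v)"
    using gain_cost by (simp add: sum_subtractf sum_distrib_left[symmetric])
  also have "\<dots> \<le> 4"
    using loss_cost sum_nonneg[of W loss] loss_nonneg by simp
  finally show False using rho_ge by simp
qed

text \<open>Such a vertex exhausts the budget: it costs at least 1, or at least 1/2 together with a
  non-leaf neighbour that costs another 1/2. The surplus \<open>2 * (1 - x a)\<close> and all loss
  must vanish.\<close>

lemma branch_extremal:
  assumes a: "a \<in> N" "dN a \<ge> 3"
  shows "x a = 1" "(\<Sum>w\<in>W. loss w) = 0"
proof -
  have "2 * (1 - x a) \<le> (real (dN a) - 1) * (1 - x a)"
    using a x_le_1[of a] by (intro mult_right_mono) auto
  then have ca: "cost a \<ge> 2 * (1 - x a) + 1 - real (inner a) / 2"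
    using a unfolding cost_def by auto
  have "(\<Sum>w\<in>W. loss w) + 2 * (1 - x a) \<le> 0"
  proof (cases "inner a = 0")
    case True
    then show ?thesis using ca cost_subset[of "{a}"] a by simp
  next
    case False
    then obtain b where b: "b \<in> N" "adj a b" "dN b \<ge> 2"
      unfolding inner_def by (metis (mono_tags, lifting) card.empty empty_Collect_eq)
    have "(real (dN b) - 1) * (1 - x b) \<ge> 0" using b x_le_1[of b] by simp
    then have "cost b \<ge> 1 / 2" using inner_le_1[OF b(1)] b(3) unfolding cost_def by auto
    moreover have "a \<noteq> b" using b adj_irrefl by blast
    ultimately show ?thesis
      using ca cost_subset[of "{a, b}"] a b inner_le_1[OF a(1)] by simp
  qed
  moreover have "(\<Sum>w\<in>W. loss w) \<ge> 0" using loss_nonneg by (intro sum_nonneg) auto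
  ultimately show "x a = 1" "(\<Sum>w\<in>W. loss w) = 0" using x_le_1[of a] by argo+
qed

text \<open>Without loss, a vertex \<open>w\<close> that has a neighbour would be joined to all of
  \<open>N\<close>. Then \<open>a\<close> is the hub of a fan over the path \<open>b\<close>,
  \<open>u\<close>, \<open>c\<close>, \<open>w\<close>, \<open>e\<close>.\<close>

lemma W_isolated:
  assumes "w \<in> W"
  shows "\<not> adj w y"
proof
  assume "adj w y"
  obtain a where a: "a \<in> N" "dN a \<ge> 3" using ex_branch by blast
  have loss: "loss w = 0"
    using branch_extremal(2)[OF a] assms loss_nonneg by (simp add: sum_nonneg_eq_0_iff)
  have "real (dN w) * (1 - x w) \<ge> 0" using x_le_1[of w] by simp
  with loss have "dW w = 0" unfolding loss_def by linarith
  then have "{z \<in> W. adj w z} = {}" unfolding dW_def by simp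
  moreover have "y \<in> V" "y \<noteq> u" using \<open>adj w y\<close> adj_V adj_sym W_not_adj_u[OF assms] by blast+
  ultimately have "y \<in> N" using \<open>adj w y\<close> V_split(1) by blast
  have all: "adj w z" if "z \<in> N" for z
  proof (rule ccontr)
    assume "\<not> adj w z"
    then have "9/10 * min (1/2) (x z) \<le> loss w"
      using that x_nonneg[of z] by (intro loss_ge[OF assms \<open>y \<in> N\<close> \<open>adj w y\<close>, of "{z}"]) auto
    then show False using loss x_N_pos[OF that] by (simp split: if_splits)
  qed
  have "3 \<le> card {y \<in> N. adj a y}" using a unfolding dN_def by simp
  then obtain T where "T \<subseteq> {y \<in> N. adj a y}" "card T = 3"
    by (meson obtain_subset_with_card_n)
  then obtain b c e where bce: "b \<in> N" "c \<in> N" "e \<in> N" "adj a b" "adj a c" "adj a e"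
    "b \<noteq> c" "b \<noteq> e" "c \<noteq> e"
    by (auto simp: card_3_iff)
  moreover have "w \<noteq> u" "w \<noteq> b" "w \<noteq> c" "w \<noteq> e" "u \<noteq> b" "u \<noteq> c" "u \<noteq> e"
    using assms bce W_not_adj_u N_not_W N_adj adj_irrefl by metis+
  ultimately show False
    using no_fan[of a b u c w e] all a(1) N_adj adj_sym by metis
qed

text \<open>The value of \<open>\<rho>\<close> comes with the shape: leaves have weight
  \<open>2 / \<rho>\<close>, and \<open>N\<close> has total weight \<open>\<rho>\<close>. Only the
  edges are described, since isolated vertices may remain.\<close>

lemma extremal_structure:
  obtains a L where "u \<noteq> a" "u \<notin> L" "a \<notin> L" "finite L" "\<rho>\<^sup>2 - \<rho> = 2 * real (card L)"
    "\<And>y z. adj y z \<longleftrightarrow> (y \<in> {u, a} \<and> z \<in> {u, a} \<and> y \<noteq> z) \<or> (y \<in> {u, a} \<and> z \<in> L) \<or> (y \<in> L \<and> z \<in> {u, a})"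
proof -
  obtain a where a: "a \<in> N" "dN a \<ge> 3" using ex_branch by blast
  have xa: "x a = 1" using branch_extremal(1)[OF a] .
  have sW: "sW v = 0" for v
    unfolding sW_def using W_isolated adj_sym by (intro sum.neutral) auto
  have dom: "adj a z" if "z \<in> N" "z \<noteq> a" for z
  proof (rule ccontr)
    assume "\<not> adj a z"
    \<comment> \<open>The vertices of \<open>N\<close> not adjacent to \<open>a\<close> have total
      weight 1, and \<open>a\<close> itself already accounts for all of it.\<close>
    have "(\<Sum>v\<in>N. of_bool (\<not> adj a v) * x v) = \<rho> - sN a"
      unfolding rho_sum[symmetric] sN_def sum_subtractf[symmetric] by (intro sum.cong) auto
    also have "\<dots> = 1" using eigen_N[OF a(1)] sW xa by simp
    finally have "1 \<ge> (\<Sum>v\<in>{a, z}. of_bool (\<not> adj a v) * x v)"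
      using sum_mono2[of N "{a, z}" "\<lambda>v. of_bool (\<not> adj a v) * x v"] a(1) that x_nonneg by simp
    then show False using that \<open>\<not> adj a z\<close> adj_irrefl xa x_N_pos[OF that(1)] by simp
  qed
  define L where "L = N - {a}"
  have N_eq: "N = insert a L" "finite L" "a \<notin> L" unfolding L_def using a by auto
  have uL: "u \<notin> L" "u \<noteq> a" unfolding L_def using V_split(2) a by auto
  have indep: "\<not> adj y z" if "y \<in> L" "z \<in> L" for y z
    using no_triangle[of a y z] dom that a unfolding L_def by blast
  have only: "y \<in> insert u N" if "adj y z" for y z
    using W_isolated adj_V[OF that] that V_split(1) by blast
  have struct: "adj y z \<longleftrightarrow> (y \<in> {u, a} \<and> z \<in> {u, a} \<and> y \<noteq> z) \<or> (y \<in> {u, a} \<and> z \<in> L) \<or> (y \<in> L \<and> z \<in> {u, a})" for y z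
  proof
    assume adj: "adj y z"
    then have "y \<in> insert u N" "z \<in> insert u N" using only adj_sym by blast+
    with adj show "(y \<in> {u, a} \<and> z \<in> {u, a} \<and> y \<noteq> z) \<or> (y \<in> {u, a} \<and> z \<in> L) \<or> (y \<in> L \<and> z \<in> {u, a})"
      using indep adj_irrefl unfolding N_eq(1) by blast
  next
    assume "(y \<in> {u, a} \<and> z \<in> {u, a} \<and> y \<noteq> z) \<or> (y \<in> {u, a} \<and> z \<in> L) \<or> (y \<in> L \<and> z \<in> {u, a})"
    then show "adj y z"
      using N_adj dom adj_sym a(1) unfolding L_def by blast
  qed
  have leaf: "\<rho> * x l = 2" if "l \<in> L" for l
  proof -
    have "l \<in> N" using that N_eq by blast
    moreover have "{z \<in> N. adj l z} = {a}" using struct that uL N_eq by auto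
    ultimately show ?thesis using eigen_N[of l] nbrs_eq(2)[of l "{a}"] sW xa by simp
  qed
  have "\<rho>\<^sup>2 - \<rho> = \<rho> * (\<rho> - 1)" by (simp add: power2_eq_square algebra_simps)
  also have "\<rho> - 1 = sum x L" using rho_sum N_eq xa by simp
  also have "\<rho> * sum x L = 2 * real (card L)" using leaf by (simp add: sum_distrib_left)
  finally show ?thesis using that[OF uL(2,1) N_eq(3,2)] struct by blast
qed

end

section \<open>Fans, books and the main theorem\<close>

lemma simple_graph_edge:
  assumes "simple_graph G" "{a, b} \<in> snd G"
  shows "a \<in> fst G" "b \<in> fst G" "a \<noteq> b"
  using assms unfolding simple_graph_def by (auto simp: doubleton_eq_iff)

lemma fan_6_subgraph:
  fixes G :: "'a graph"
  assumes "simple_graph G"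
    and hub: "{h, a} \<in> snd G" "{h, b} \<in> snd G" "{h, c} \<in> snd G" "{h, d} \<in> snd G" "{h, e} \<in> snd G"
    and path: "{a, b} \<in> snd G" "{b, c} \<in> snd G" "{c, d} \<in> snd G" "{d, e} \<in> snd G"
    and dist: "a \<noteq> c" "a \<noteq> d" "a \<noteq> e" "b \<noteq> d" "b \<noteq> e" "c \<noteq> e"
  shows "contains_subgraph G (fan_graph 6)"
  unfolding contains_subgraph_def
proof (intro exI conjI)
  let ?l = "[a, b, c, d, e]"
  let ?f = "case_sum (\<lambda>_. h) (\<lambda>i. ?l ! i) :: nat + nat \<Rightarrow> 'a"
  note edge = simple_graph_edge[OF assms(1)]
  have l: "distinct ?l" "h \<notin> set ?l" using dist edge(3)[OF path(1)] edge(3)[OF path(2)] edge(3)[OF path(3)]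
      edge(3)[OF path(4)] edge(3)[OF hub(1)] edge(3)[OF hub(2)] edge(3)[OF hub(3)] edge(3)[OF hub(4)] edge(3)[OF hub(5)]
    by auto
  have "{0..<5::nat} = {0, 1, 2, 3, 4}" by auto
  then have fst_fan: "fst (fan_graph 6) = {Inl 0, Inr 0, Inr 1, Inr 2, Inr 3, Inr 4}"
    by (auto simp: fan_graph_def join_def complete_graph_def path_graph_def)
  show "inj_on ?f (fst (fan_graph 6))"
    unfolding fst_fan using l by (auto simp: inj_on_def)
  show "?f ` fst (fan_graph 6) \<subseteq> fst G"
    unfolding fst_fan using hub edge by auto
  have five: "i = 0 \<or> i = 1 \<or> i = 2 \<or> i = 3 \<or> i = 4" if "i < 5" for i :: nat using that by linarith
  have four: "i = 0 \<or> i = 1 \<or> i = 2 \<or> i = 3" if "Suc i < 5" for i :: nat using that by linarith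
  show "\<forall>E\<in>snd (fan_graph 6). ?f ` E \<in> snd G"
  proof
    fix E assume "E \<in> snd (fan_graph 6)"
    then consider i where "Suc i < 5" "E = {Inr i, Inr (Suc i)}" | i where "i < 5" "E = {Inl 0, Inr i}"
      by (auto simp: fan_graph_def join_def complete_graph_def path_graph_def)
    then show "?f ` E \<in> snd G"
    proof cases
      case 1
      then show ?thesis using four[of i] path by auto
    next
      case 2
      then show ?thesis using five[of i] hub by auto
    qed
  qed
qed

lemma handshake:
  assumes "simple_graph G"
  shows "(\<Sum>v\<in>fst G. \<Sum>y\<in>fst G. of_bool ({v, y} \<in> snd G)) = 2 * real (num_edges G)"
proof -
  have fin: "finite (fst G)" using assms unfolding simple_graph_def by blast
  have edge: "\<exists>a b. a \<noteq> b \<and> a \<in> fst G \<and> b \<in> fst G \<and> e = {a, b}" if "e \<in> snd G" for e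
    using assms that unfolding simple_graph_def by simp
  have sub: "snd G \<subseteq> Pow (fst G)"
  proof
    fix e assume "e \<in> snd G"
    with edge[of e] show "e \<in> Pow (fst G)" by auto
  qed
  have finE: "finite (snd G)" using finite_subset[OF sub] fin by simp
  have "card {y \<in> fst G. {v, y} \<in> snd G} = card {e \<in> snd G. v \<in> e}" for v
  proof (rule bij_betw_same_card)
    show "bij_betw (\<lambda>y. {v, y}) {y \<in> fst G. {v, y} \<in> snd G} {e \<in> snd G. v \<in> e}"
      unfolding bij_betw_def
    proof
      show "inj_on (\<lambda>y. {v, y}) {y \<in> fst G. {v, y} \<in> snd G}"
        by (auto simp: inj_on_def doubleton_eq_iff)
      have "\<exists>y\<in>fst G. e = {v, y}" if "e \<in> snd G" "v \<in> e" for e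
        using edge[OF that(1)] that(2) by auto
      then show "(\<lambda>y. {v, y}) ` {y \<in> fst G. {v, y} \<in> snd G} = {e \<in> snd G. v \<in> e}" by blast
    qed
  qed
  then have "(\<Sum>v\<in>fst G. \<Sum>y\<in>fst G. of_bool ({v, y} \<in> snd G)) = (\<Sum>v\<in>fst G. real (card {e \<in> snd G. v \<in> e}))"
    using fin by (simp add: Int_def)
  also have "\<dots> = (\<Sum>v\<in>fst G. \<Sum>e\<in>snd G. of_bool (v \<in> e))"
    using finE by (simp add: Int_def)
  also have "\<dots> = (\<Sum>e\<in>snd G. \<Sum>v\<in>fst G. of_bool (v \<in> e))" by (rule sum.swap)
  also have "\<dots> = (\<Sum>e\<in>snd G. 2)"
  proof (intro sum.cong refl)
    fix e assume "e \<in> snd G"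
    then obtain a b where "a \<noteq> b" "a \<in> fst G" "b \<in> fst G" "e = {a, b}"
      using edge[OF \<open>e \<in> snd G\<close>] by auto
    then have "fst G \<inter> e = {a, b}" "a \<noteq> b" by blast+
    then have "card {v \<in> fst G. v \<in> e} = 2" by (simp add: Int_def)
    then show "(\<Sum>v\<in>fst G. of_bool (v \<in> e)) = (2::real)"
      using card_filter_of_bool[OF fin, of "\<lambda>v. v \<in> e"] by simp
  qed
  finally show ?thesis by (simp add: num_edges_def)
qed

section \<open>The graph K2 joined to an empty graph, and the value of the bound\<close>

lemma book_edge_iff:
  "{p, q} \<in> snd (join (complete_graph 2) (empty_graph t)) \<longleftrightarrow>
    (\<exists>i j. p = Inl i \<and> q = Inl j \<and> i < 2 \<and> j < 2 \<and> i \<noteq> j) \<or>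
    (\<exists>i j. p = Inl i \<and> q = Inr j \<and> i < 2 \<and> j < t) \<or>
    (\<exists>i j. p = Inr j \<and> q = Inl i \<and> i < 2 \<and> j < t)"
  by (auto simp: join_def complete_graph_def empty_graph_def doubleton_eq_iff image_iff) blast+

lemma book_vertices:
  "fst (join (complete_graph 2) (empty_graph t)) = {Inl 0, Inl 1} \<union> Inr ` {0..<t}"
  by (auto simp: join_def complete_graph_def empty_graph_def)

text \<open>The positive root of \<open>t^2 - t = m - 1\<close>.\<close>

definition bound where "bound m = (1 + sqrt (4 * real m - 3)) / 2"

lemma bound_square:
  assumes "m \<ge> 1"
  shows "(bound m)\<^sup>2 = bound m + real m - 1"
proof -
  have "(sqrt (4 * real m - 3))\<^sup>2 = 4 * real m - 3" using assms by simp
  then show ?thesis unfolding bound_def by (simp add: power2_eq_square field_simps)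
qed

lemma bound_ge:
  assumes "m \<ge> 88"
  shows "bound m \<ge> 49/5"
proof -
  \<comment> \<open>The left side is 345.96, just below \<open>4 * 88 - 3 = 349\<close>.\<close>
  have "(93/5)\<^sup>2 \<le> 4 * real m - 3" using assms by (simp add: power2_eq_square)
  then have "93/5 \<le> sqrt (4 * real m - 3)" by (rule real_le_rsqrt)
  then show ?thesis by (simp add: bound_def)
qed

lemma book_eigenvalue:
  assumes m: "m = 2 * t + 1"
    and iso: "graph_iso (drop_isolated G) (join (complete_graph 2) (empty_graph t))"
    and fin: "finite (fst G)"
  shows "adj_eigenvalue G (bound m)"
proof -
  let ?K = "join (complete_graph 2) (empty_graph t)" and ?V = "fst (drop_isolated G)"
  obtain f where bij: "bij_betw f ?V (fst ?K)"
    and edges: "\<And>a b. a \<in> ?V \<Longrightarrow> b \<in> ?V \<Longrightarrow> {a, b} \<in> snd G \<longleftrightarrow> {f a, f b} \<in> snd ?K"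
    using iso unfolding graph_iso_def drop_isolated_def by auto
  have V: "v \<in> ?V \<longleftrightarrow> v \<in> fst G \<and> (\<exists>e\<in>snd G. v \<in> e)" for v unfolding drop_isolated_def by simp
  \<comment> \<open>The value 2 settles the equation at the independent vertices; at the two others
    it becomes \<open>bound_square\<close> with \<open>2 * t = m - 1\<close>.\<close>
  define y :: "nat + nat \<Rightarrow> real" where "y = case_sum (\<lambda>_. bound m) (\<lambda>_. 2)"
  define x where "x v = (if v \<in> ?V then y (f v) else 0)" for v
  have pos: "bound m > 0" unfolding bound_def using m by (simp add: add_pos_nonneg)
  have K: "(\<Sum>q\<in>{q\<in>fst ?K. {q, p} \<in> snd ?K}. y q) = bound m * y p" if "p \<in> fst ?K" for p
  proof -
    consider "p = Inl 0" | "p = Inl 1" | j where "p = Inr j" "j < t"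
      using \<open>p \<in> fst ?K\<close> unfolding book_vertices by auto
    then show ?thesis
    proof cases
      case 1
      then have "{q\<in>fst ?K. {q, p} \<in> snd ?K} = insert (Inl 1) (Inr ` {0..<t})"
        unfolding book_edge_iff book_vertices by auto
      then show ?thesis using 1 bound_square[of m] m
        by (simp add: y_def sum.reindex image_iff power2_eq_square)
    next
      case 2
      then have "{q\<in>fst ?K. {q, p} \<in> snd ?K} = insert (Inl 0) (Inr ` {0..<t})"
        unfolding book_edge_iff book_vertices by auto
      then show ?thesis using 2 bound_square[of m] m
        by (simp add: y_def sum.reindex image_iff power2_eq_square)
    next
      case 3
      then have "{q\<in>fst ?K. {q, p} \<in> snd ?K} = {Inl 0, Inl 1}"
        unfolding book_edge_iff book_vertices by auto
      then show ?thesis using 3 by (simp add: y_def)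
    qed
  qed
  have "(\<Sum>a\<in>{a\<in>fst G. {a, v} \<in> snd G}. x a) = bound m * x v" if v: "v \<in> fst G" for v
  proof (cases "v \<in> ?V")
    case False
    then have "{a\<in>fst G. {a, v} \<in> snd G} = {}" using v V by blast
    then have "(\<Sum>a\<in>{a\<in>fst G. {a, v} \<in> snd G}. x a) = 0" by (simp only: sum.empty)
    with False show ?thesis by (simp add: x_def)
  next
    case True
    have "{a\<in>fst G. {a, v} \<in> snd G} = {a\<in>?V. {f a, f v} \<in> snd ?K}"
    proof (rule Collect_cong)
      fix a
      have "a \<in> ?V" if "a \<in> fst G" "{a, v} \<in> snd G" using V that by blast
      then show "a \<in> fst G \<and> {a, v} \<in> snd G \<longleftrightarrow> a \<in> ?V \<and> {f a, f v} \<in> snd ?K"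
        using edges[OF _ True, of a] V[of a] by auto
    qed
    then have "(\<Sum>a\<in>{a\<in>fst G. {a, v} \<in> snd G}. x a) = (\<Sum>a\<in>{a\<in>?V. {f a, f v} \<in> snd ?K}. y (f a))"
      by (simp add: x_def)
    also have "\<dots> = (\<Sum>q\<in>{q\<in>fst ?K. {q, f v} \<in> snd ?K}. y q)"
    proof (rule sum.reindex_bij_betw)
      show "bij_betw f {a\<in>?V. {f a, f v} \<in> snd ?K} {q\<in>fst ?K. {q, f v} \<in> snd ?K}"
        using bij unfolding bij_betw_def inj_on_def image_def by blast
    qed
    also have "\<dots> = bound m * y (f v)"
      using K bij True by (meson bij_betwE)
    finally show ?thesis using True by (simp add: x_def)
  qed
  moreover have "\<exists>v\<in>fst G. x v \<noteq> 0"
  proof -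
    have "Inl 0 \<in> f ` ?V" using bij unfolding bij_betw_def book_vertices by blast
    then obtain v where "v \<in> ?V" "f v = Inl 0" by (metis imageE)
    then have "v \<in> fst G" "x v \<noteq> 0" using V pos by (auto simp: x_def y_def)
    then show ?thesis by blast
  qed
  ultimately show ?thesis unfolding adj_eigenvalue_def by blast
qed

lemma extremal_graph:
  fixes G :: "'a graph"
  assumes simple: "simple_graph G" and free: "free_of G (fan_graph 6)"
    and m: "num_edges G = m" "m \<ge> 88" and ge: "spectral_radius G \<ge> bound m"
  obtains u a L where "u \<noteq> a" "u \<notin> L" "a \<notin> L" "finite L"
    "(spectral_radius G)\<^sup>2 - spectral_radius G = 2 * real (card L)"
    "\<And>y z. {y, z} \<in> snd G \<longleftrightarrow> (y \<in> {u, a} \<and> z \<in> {u, a} \<and> y \<noteq> z) \<or> (y \<in> {u, a} \<and> z \<in> L) \<or> (y \<in> L \<and> z \<in> {u, a})"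
proof -
  let ?\<rho> = "spectral_radius G"
  have fin: "finite (fst G)" using simple unfolding simple_graph_def by blast
  have "snd G \<noteq> {}" using m unfolding num_edges_def by auto
  then have ne: "fst G \<noteq> {}" using simple unfolding simple_graph_def by blast
  obtain y where y: "\<And>v. y v \<ge> 0" "\<And>v. v \<notin> fst G \<Longrightarrow> y v = 0" "\<exists>v\<in>fst G. y v \<noteq> 0"
    and eig: "\<And>v. v \<in> fst G \<Longrightarrow> (\<Sum>b\<in>fst G. of_bool ({v, b} \<in> snd G) * y b) = ?\<rho> * y v"
    using spectral_radius_perron[OF fin ne] by blast
  have "Max (y ` fst G) \<in> y ` fst G" using fin ne by (intro Max_in) auto
  then obtain u where u: "u \<in> fst G" "y u = Max (y ` fst G)" by (metis imageE)
  have le_u: "y v \<le> y u" for v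
    using y(1)[of u] y(2)[of v] u fin by (cases "v \<in> fst G") auto
  have pos: "y u > 0" using y(1,3) le_u by (metis less_le order.antisym)
  define x where "x v = y v / y u" for v
  have big: "?\<rho> \<ge> 49/5" using bound_ge[OF m(2)] ge by simp
  \<comment> \<open>Factorised form of the monotonicity of \<open>t^2 - t\<close>, which carries the
    assumption on \<open>\<rho>\<close> over to
    \<open>m - 1 \<le> \<rho>\<^sup>2 - \<rho>\<close>.\<close>
  have "(?\<rho> - bound m) * (?\<rho> + bound m - 1) \<ge> 0"
    using ge big bound_ge[OF m(2)] by simp
  then have sq: "real m - 1 \<le> ?\<rho>\<^sup>2 - ?\<rho>"
    using bound_square[of m] m(2) by (simp add: algebra_simps power2_eq_square)
  interpret fan_free_eigenvector "fst G" "\<lambda>a b. {a, b} \<in> snd G" x ?\<rho> u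
  proof
    show "finite (fst G)" "u \<in> fst G" "49/5 \<le> ?\<rho>" using fin u big by auto
    show "x u = 1" using pos by (simp add: x_def)
    show "0 \<le> x v" "x v \<le> 1" for v using y(1)[of v] le_u[of v] pos by (simp_all add: x_def)
    show "{b, a} \<in> snd G" if "{a, b} \<in> snd G" for a b using that by (simp add: insert_commute)
    show "{a, a} \<notin> snd G" for a using simple_graph_edge(3)[OF simple, of a a] by blast
    show "a \<in> fst G" if "{a, b} \<in> snd G" for a b using simple_graph_edge(1)[OF simple that] .
    show "(\<Sum>b\<in>fst G. of_bool ({v, b} \<in> snd G) * x b) = ?\<rho> * x v" if "v \<in> fst G" for v
    proof -
      have "(\<Sum>b\<in>fst G. of_bool ({v, b} \<in> snd G) * x b) = (\<Sum>b\<in>fst G. of_bool ({v, b} \<in> snd G) * y b) / y u"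
        by (simp add: x_def sum_divide_distrib del: sum_of_bool_mult_eq)
      then show ?thesis using eig[OF that] by (simp add: x_def)
    qed
    show "(\<Sum>v\<in>fst G. \<Sum>y\<in>fst G. of_bool ({v, y} \<in> snd G)) \<le> 2 * (?\<rho>\<^sup>2 - ?\<rho> + 1)"
      unfolding handshake[OF simple] m(1) using sq by simp
    show False if "{h, a} \<in> snd G" "{h, b} \<in> snd G" "{h, c} \<in> snd G" "{h, d} \<in> snd G" "{h, e} \<in> snd G"
      "{a, b} \<in> snd G" "{b, c} \<in> snd G" "{c, d} \<in> snd G" "{d, e} \<in> snd G"
      "a \<noteq> c" "a \<noteq> d" "a \<noteq> e" "b \<noteq> d" "b \<noteq> e" "c \<noteq> e" for h a b c d e
      using fan_6_subgraph[OF simple that] free unfolding free_of_def by blast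
  qed
  show ?thesis by (rule extremal_structure) (rule that)
qed

lemma book_of_structure:
  fixes G :: "'a graph"
  assumes simple: "simple_graph G" and dist: "u \<noteq> a" "u \<notin> L" "a \<notin> L" and fin: "finite L"
    and adj: "\<And>y z. {y, z} \<in> snd G \<longleftrightarrow> (y \<in> {u, a} \<and> z \<in> {u, a} \<and> y \<noteq> z) \<or>
      (y \<in> {u, a} \<and> z \<in> L) \<or> (y \<in> L \<and> z \<in> {u, a})"
  shows "num_edges G = 2 * card L + 1"
    "graph_iso (drop_isolated G) (join (complete_graph 2) (empty_graph (card L)))"
proof -
  have edges: "snd G = insert {u, a} ((\<lambda>l. {u, l}) ` L \<union> (\<lambda>l. {a, l}) ` L)" (is "_ = ?E")
  proof
    show "?E \<subseteq> snd G" using adj dist by auto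
    show "snd G \<subseteq> ?E"
    proof
      fix e assume e: "e \<in> snd G"
      then obtain y z where yz: "e = {y, z}" using simple unfolding simple_graph_def by blast
      with e have "{y, z} \<in> snd G" by simp
      then show "e \<in> ?E" unfolding adj yz by (auto simp: insert_commute)
    qed
  qed
  have "card ((\<lambda>l. {u, l}) ` L \<union> (\<lambda>l. {a, l}) ` L) = card ((\<lambda>l. {u, l}) ` L) + card ((\<lambda>l. {a, l}) ` L)"
    using fin dist by (intro card_Un_disjoint) (auto simp: doubleton_eq_iff)
  also have "\<dots> = 2 * card L"
    by (subst (1 2) card_image) (auto simp: inj_on_def doubleton_eq_iff)
  finally show "num_edges G = 2 * card L + 1"
    unfolding num_edges_def edges using fin dist by (subst card_insert_disjoint) (auto simp: doubleton_eq_iff)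
  let ?K = "join (complete_graph 2) (empty_graph (card L))"
  have "v \<in> fst (drop_isolated G) \<longleftrightarrow> v \<in> {u, a} \<union> L" for v
  proof
    assume "v \<in> fst (drop_isolated G)"
    then obtain e where "e \<in> snd G" "v \<in> e" unfolding drop_isolated_def by auto
    then show "v \<in> {u, a} \<union> L" unfolding edges by auto
  next
    assume "v \<in> {u, a} \<union> L"
    then obtain w where w: "{v, w} \<in> snd G" using adj dist by blast
    moreover have "v \<in> {v, w}" by simp
    ultimately show "v \<in> fst (drop_isolated G)"
      using simple_graph_edge(1)[OF simple w] unfolding drop_isolated_def by (simp add: bexI[of _ "{v, w}"])
  qed
  then have V: "fst (drop_isolated G) = {u, a} \<union> L" by blast
  obtain g where g: "bij_betw g L {0..<card L}" using ex_bij_betw_finite_nat[OF fin] by blast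
  define f :: "'a \<Rightarrow> nat + nat" where "f v = (if v = u then Inl 0 else if v = a then Inl 1 else Inr (g v))" for v
  have f: "f u = Inl 0" "f a = Inl 1" "\<And>l. l \<in> L \<Longrightarrow> f l = Inr (g l)"
    using dist by (auto simp: f_def)
  have gL: "g l < card L" if "l \<in> L" for l using g that by (auto dest: bij_betwE)
  show "graph_iso (drop_isolated G) ?K"
    unfolding graph_iso_def
  proof (intro exI conjI ballI)
    show "bij_betw f (fst (drop_isolated G)) (fst ?K)"
    proof -
      have "bij_betw (Inr \<circ> g) L (Inr ` {0..<card L} :: (nat + nat) set)"
        by (rule bij_betw_trans[OF g]) (simp add: bij_betw_def)
      then have "bij_betw f L (Inr ` {0..<card L})"
        using f(3) by (subst bij_betw_cong[of L f "Inr \<circ> g"]) simp_all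
      moreover have "bij_betw f {u, a} {Inl 0, Inl 1}"
        using f dist unfolding bij_betw_def by (auto simp: inj_on_def)
      ultimately show ?thesis
        unfolding V book_vertices by (intro bij_betw_combine) auto
    qed
    fix v w assume "v \<in> fst (drop_isolated G)" "w \<in> fst (drop_isolated G)"
    then show "{v, w} \<in> snd (drop_isolated G) \<longleftrightarrow> {f v, f w} \<in> snd ?K"
      unfolding V book_edge_iff using f gL dist adj[of v w] by (auto simp: drop_isolated_def)
  qed
qed

theorem theorem1p2:
  fixes G :: "'a graph" and m :: nat
  assumes "simple_graph G"
    and "free_of G (fan_graph 6)"
    and "num_edges G = m"
    and "m \<ge> 88"
  shows "spectral_radius G \<le> (1 + sqrt (4 * real m - 3)) / 2
    \<and> (spectral_radius G = (1 + sqrt (4 * real m - 3)) / 2 \<longleftrightarrow>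
         (\<exists>t. m = 2 * t + 1 \<and>
               graph_iso (drop_isolated G) (join (complete_graph 2) (empty_graph t))))"
proof -
  let ?\<rho> = "spectral_radius G"
  \<comment> \<open>Reaching the bound already implies equality, so exceeding it is impossible; the
    upper bound and one direction of the characterisation follow together.\<close>
  have book: "?\<rho> = bound m \<and> (\<exists>t. m = 2 * t + 1 \<and>
      graph_iso (drop_isolated G) (join (complete_graph 2) (empty_graph t)))" if ge: "?\<rho> \<ge> bound m"
  proof -
    obtain u a L where L: "u \<noteq> a" "u \<notin> L" "a \<notin> L" "finite L"
      and sq: "?\<rho>\<^sup>2 - ?\<rho> = 2 * real (card L)"
      and adj: "\<And>y z. {y, z} \<in> snd G \<longleftrightarrow> (y \<in> {u, a} \<and> z \<in> {u, a} \<and> y \<noteq> z) \<or>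
        (y \<in> {u, a} \<and> z \<in> L) \<or> (y \<in> L \<and> z \<in> {u, a})"
      by (rule extremal_graph[OF assms ge]) (rule that)
    note K = book_of_structure[OF assms(1) L adj]
    have m: "m = 2 * card L + 1" using K(1) assms(3) by simp
    have "(?\<rho> - bound m) * (?\<rho> + bound m - 1) = 0"
      using sq bound_square[of m] m by (simp add: algebra_simps power2_eq_square)
    then have "?\<rho> = bound m" using ge bound_ge[OF assms(4)] by auto
    with m K(2) show ?thesis by blast
  qed
  have "bound m \<le> ?\<rho>" if "m = 2 * t + 1"
    "graph_iso (drop_isolated G) (join (complete_graph 2) (empty_graph t))" for t
    using adj_eigenvalue_le book_eigenvalue[OF that] assms(1) unfolding simple_graph_def by blast
  with book show ?thesis unfolding bound_def[symmetric] by (metis linear order_refl)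
qed

end
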